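(* There is an online algorithm that 2-colors the edges of the online random edge process on $n$ vertices and a constant $c>0$ such that, with high probability, after $0.733n$ rounds both color classes contain a connected component of order at least $c n$.
   Context: Online random edge process: there are $n$ vertices and a sequence of rounds; in each round one edge arrives, chosen uniformly at random among all pairs of distinct vertices, independently of previous rounds (repetitions are possible). The algorithm must color each edge upon arrival, using only the history so far. "With high probability" means with probability tending to $1$ as $n\to\infty$. *)

theory Defs
  imports "HOL-Probability.Probability" "HOL-Library.Ramsey"
begin

type_synonym edge = "nat set"

definition all_edges :: "nat \<Rightarrow> edge set" where
  "all_edges n = nsets {..<n} 2"

(* Only meaningful for n \<ge> 2: for smaller n there are no edges to draw from.
   The list records the edges in order of arrival. *)
definition edge_process :: "nat \<Rightarrow> nat \<Rightarrow> edge list pmf" where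
  "edge_process n m = replicate_pmf m (pmf_of_set (all_edges n))"

datatype colour = Red | Blue

(* An algorithm gets the edges of all previous rounds and the edge that has just arrived.
   The colours used in previous rounds are functions of the earlier edges, so they need
   not be passed as a separate argument. *)
type_synonym online_algorithm = "edge list \<Rightarrow> edge \<Rightarrow> colour"

definition colour_of_round :: "online_algorithm \<Rightarrow> edge list \<Rightarrow> nat \<Rightarrow> colour" where
  "colour_of_round A es i = A (take i es) (es ! i)"

(* An edge that arrives repeatedly may receive both colours and then lies in both classes. *)
definition colour_class :: "online_algorithm \<Rightarrow> edge list \<Rightarrow> colour \<Rightarrow> edge set" where
  "colour_class A es k = {es ! i | i. i < length es \<and> colour_of_round A es i = k}"

definition graph_component :: "nat set \<Rightarrow> edge set \<Rightarrow> nat \<Rightarrow> nat set" where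
  "graph_component V E v = {w \<in> V. (v, w) \<in> {(x, y). {x, y} \<in> E}\<^sup>*}"

definition graph_components :: "nat set \<Rightarrow> edge set \<Rightarrow> nat set set" where
  "graph_components V E = graph_component V E ` V"

end

theory Submission
  imports Defs
begin

text \<open>
  Colour the first \<open>0.175 n\<close> edges red and then fix a set \<open>T\<close> of about \<open>0.641 n\<close> vertices that no edge
  has touched yet (at least \<open>n - 0.35 n\<close> vertices are untouched, whatever the edges are). For the next
  \<open>0.5575 n\<close> rounds colour an edge blue if it meets \<open>T\<close> and red otherwise. At the end of this phase both
  colours are just supercritical, and \<open>0.00025 n\<close> more edges of each colour create the giants.

  Supercriticality is read off the potential that averages \<open>1 - exp (- weight of the component of v)\<close>
  over the vertices \<open>v\<close> of each type, where a vertex of type \<open>i\<close> has weight \<open>\<theta> i\<close>. In the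
  fluid limit it satisfies a system of Burgers equations, whose characteristics are straight lines: if the potential
  is at least \<open>b\<close> and \<open>\<theta>\<close> decreases by \<open>(2 / n) A b\<close> in each round (\<open>A\<close> being the matrix of the
  pairs of types that receive the colour), then the potential stays at least \<open>b\<close>. For the random process, the
  expected squared shortfall below \<open>b\<close> obeys a Gronwall recursion with error \<open>O(1 / n\<^sup>2)\<close> per
  round. If \<open>\<theta>\<close> ends at a tiny value, then a positive fraction of the vertices, independent of that value, lies in
  components larger than any prescribed constant, and sprinkling joins these.
\<close>

subsection \<open>Components\<close>

definition joined :: "edge set \<Rightarrow> nat \<Rightarrow> nat \<Rightarrow> bool" where
  "joined E x y \<longleftrightarrow> (x, y) \<in> {(x, y). {x, y} \<in> E}\<^sup>*"

abbreviation comp :: "nat \<Rightarrow> edge set \<Rightarrow> nat \<Rightarrow> nat set" where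
  "comp n \<equiv> graph_component {..<n}"

lemma mem_comp: "w \<in> comp n E v \<longleftrightarrow> w < n \<and> joined E v w"
  unfolding graph_component_def joined_def by blast

lemma joined_refl: "joined E x x"
  unfolding joined_def by blast

lemma joined_sym: "joined E x y \<Longrightarrow> joined E y x"
proof -
  have "sym ({(x, y). {x, y} \<in> E}\<^sup>*)"
  proof (rule sym_rtrancl, rule symI)
    fix a b
    assume "(a, b) \<in> {(x, y). {x, y} \<in> E}"
    then show "(b, a) \<in> {(x, y). {x, y} \<in> E}" by (simp add: insert_commute)
  qed
  then show "joined E x y \<Longrightarrow> joined E y x"
    unfolding joined_def by (rule symD)
qed

lemma joined_trans: "joined E x y \<Longrightarrow> joined E y z \<Longrightarrow> joined E x z"
  unfolding joined_def by (rule rtrancl_trans)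

lemma joined_mono:
  assumes "E \<subseteq> E'" "joined E x y"
  shows "joined E' x y"
proof -
  have "{(x, y). {x, y} \<in> E} \<subseteq> {(x, y). {x, y} \<in> E'}"
    using assms(1) by blast
  then show ?thesis
    using assms(2) rtrancl_mono unfolding joined_def by blast
qed

lemma joined_edge: "{x, y} \<in> E \<Longrightarrow> joined E x y"
  unfolding joined_def by (rule r_into_rtrancl) simp

lemma joined_insert:
  "joined (insert {u, v} E) x y \<longleftrightarrow>
    joined E x y \<or> joined E x u \<and> joined E v y \<or> joined E x v \<and> joined E u y"
proof -
  \<comment> \<open>One edge contributes two ordered pairs, so \<open>rtrancl_insert\<close> is
    applied twice; walks that pass the new edge more than once are shortened by symmetry and
    transitivity.\<close>
  have "{(x, y). {x, y} \<in> insert {u, v} E} = insert (u, v) (insert (v, u) {(x, y). {x, y} \<in> E})"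
    by (intro set_eqI) (simp add: doubleton_eq_iff split_paired_all)
  then have "joined (insert {u, v} E) x y \<longleftrightarrow>
      (joined E x y \<or> joined E x v \<and> joined E u y) \<or>
      (joined E x u \<or> joined E x v \<and> joined E u u) \<and> (joined E v y \<or> joined E v v \<and> joined E u y)"
    unfolding joined_def by (simp only: rtrancl_insert mem_Collect_eq Un_iff case_prod_conv)
  then show ?thesis
    using joined_refl joined_sym joined_trans by metis
qed

lemma comp_subset: "comp n E v \<subseteq> {..<n}"
  unfolding graph_component_def by blast

lemma finite_comp [simp]: "finite (comp n E v)"
  by (rule finite_subset[OF comp_subset]) simp

lemma comp_self: "v < n \<Longrightarrow> v \<in> comp n E v"
  by (simp add: mem_comp joined_refl)

lemma comp_eqI:
  assumes "u \<in> comp n E v"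
  shows "comp n E u = comp n E v"
  using assms joined_sym joined_trans unfolding set_eq_iff mem_comp by blast

lemma comp_sym:
  assumes "u < n" "v \<in> comp n E u"
  shows "u \<in> comp n E v"
  using assms joined_sym unfolding mem_comp by blast

lemma comp_mono: "E \<subseteq> E' \<Longrightarrow> comp n E v \<subseteq> comp n E' v"
  using joined_mono by (auto simp: mem_comp)

lemma comp_insert:
  assumes "u < n" "v < n" "z < n"
  shows "comp n (insert {u, v} E) z =
    (if z \<in> comp n E u \<union> comp n E v then comp n E u \<union> comp n E v else comp n E z)"
proof (cases "z \<in> comp n E u \<union> comp n E v")
  case True
  then have "y \<in> comp n (insert {u, v} E) z \<longleftrightarrow> y \<in> comp n E u \<union> comp n E v" for y
    unfolding Un_iff mem_comp joined_insert using joined_sym joined_trans by meson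
  with True show ?thesis by (simp add: set_eq_iff)
next
  case False
  then have "\<not> joined E z u" "\<not> joined E z v"
    unfolding Un_iff mem_comp using joined_sym assms by blast+
  then have "y \<in> comp n (insert {u, v} E) z \<longleftrightarrow> y \<in> comp n E z" for y
    unfolding mem_comp joined_insert by blast
  with False show ?thesis by (simp add: set_eq_iff)
qed

lemma comp_isolated:
  assumes "v < n" "\<And>e. e \<in> E \<Longrightarrow> v \<notin> e"
  shows "comp n E v = {v}"
proof -
  have "y = v" if "joined E v y" for y
    using that unfolding joined_def
  proof (cases rule: converse_rtranclE)
    case (step z)
    then show ?thesis using assms(2)[of "{v, z}"] by simp
  qed simp
  then show ?thesis
    using assms(1) joined_refl by (auto simp: mem_comp)
qed

subsection \<open>Averages over a random edge\<close>

lemma all_edges_alt: "all_edges n = (\<lambda>(u, v). {u, v}) ` {(u, v). u < v \<and> v < n}"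
  unfolding all_edges_def ordered_nsets_2_eq by (force simp: image_iff)

text \<open>Every edge comes from exactly two ordered pairs. Sums over ordered pairs split vertex by
  vertex, which is how averages over a random edge are evaluated.\<close>

lemma sum_all_edges:
  fixes f :: "edge \<Rightarrow> real"
  shows "(\<Sum>u<n. \<Sum>v\<in>{..<n} - {u}. f {u, v}) = 2 * (\<Sum>e\<in>all_edges n. f e)"
proof -
  let ?P = "{(u, v). u < v \<and> v < n}"
  have fin: "finite ?P"
    by (rule finite_subset[of _ "{..<n} \<times> {..<n}"]) auto
  have inj: "inj_on (\<lambda>(u, v). {u, v}) ?P"
    by (auto simp: inj_on_def doubleton_eq_iff)
  have "(\<Sum>u<n. \<Sum>v\<in>{..<n} - {u}. f {u, v}) = (\<Sum>(u, v)\<in>Sigma {..<n} (\<lambda>u. {..<n} - {u}). f {u, v})"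
    by (rule sum.Sigma) auto
  also have "Sigma {..<n} (\<lambda>u. {..<n} - {u}) = ?P \<union> prod.swap ` ?P"
  proof (intro equalityI subsetI)
    fix p assume "p \<in> Sigma {..<n} (\<lambda>u. {..<n} - {u})"
    then obtain u v where p: "p = (u, v)" "u < n" "v < n" "u \<noteq> v" by auto
    show "p \<in> ?P \<union> prod.swap ` ?P"
    proof (cases "u < v")
      case False
      then have "(v, u) \<in> ?P" "p = prod.swap (v, u)" using p by auto
      then show ?thesis by blast
    qed (use p in auto)
  qed auto
  also have "(\<Sum>(u, v)\<in>?P \<union> prod.swap ` ?P. f {u, v}) =
      (\<Sum>(u, v)\<in>?P. f {u, v}) + (\<Sum>(u, v)\<in>prod.swap ` ?P. f {u, v})"
    using fin by (intro sum.union_disjoint) auto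
  also have "(\<Sum>(u, v)\<in>prod.swap ` ?P. f {u, v}) = (\<Sum>(u, v)\<in>?P. f {u, v})"
    by (subst sum.reindex) (auto simp: case_prod_beta insert_commute intro!: sum.cong)
  also have "(\<Sum>(u, v)\<in>?P. f {u, v}) = (\<Sum>e\<in>all_edges n. f e)"
    unfolding all_edges_alt by (subst sum.reindex[OF inj]) (auto simp: case_prod_beta)
  finally show ?thesis by simp
qed

lemma finite_all_edges [simp]: "finite (all_edges n)"
  unfolding all_edges_def by (rule finite_imp_finite_nsets) simp

lemma card_all_edges: "2 * real (card (all_edges n)) = real n * (real n - 1)"
proof -
  have "2 * real (card (all_edges n)) = (\<Sum>u<n. \<Sum>v\<in>{..<n} - {u}. 1)"
    using sum_all_edges[of "\<lambda>_. 1" n] by simp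
  also have "\<dots> = (\<Sum>u<n. real n - 1)"
    by (rule sum.cong) (auto simp: of_nat_diff)
  finally show ?thesis by simp
qed

lemma all_edges_nonempty:
  assumes "n \<ge> 2"
  shows "all_edges n \<noteq> {}"
proof -
  have "{0, 1} \<in> all_edges n" unfolding all_edges_def using assms by simp
  then show ?thesis by blast
qed

lemma expectation_edge:
  assumes "n \<ge> 2"
  shows "measure_pmf.expectation (pmf_of_set (all_edges n)) f =
    (\<Sum>u<n. \<Sum>v\<in>{..<n} - {u}. f {u, v}) / (real n * (real n - 1))"
  using card_all_edges[of n] all_edges_nonempty[OF assms]
  by (simp add: integral_pmf_of_set sum_all_edges field_simps flip: card_all_edges)

lemma set_pmf_edge [simp]:
  "n \<ge> 2 \<Longrightarrow> set_pmf (pmf_of_set (all_edges n)) = all_edges n"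
  by (rule set_pmf_of_set) (simp_all add: all_edges_nonempty)

subsection \<open>The potential and its change when an edge is added\<close>

definition wt :: "nat \<Rightarrow> edge set \<Rightarrow> (nat \<Rightarrow> real) \<Rightarrow> nat \<Rightarrow> real" where
  "wt n E \<tau> v = (\<Sum>u\<in>comp n E v. \<tau> u)"

text \<open>For nonnegative weights: if every vertex \<open>u\<close> independently carried a
  Poisson number of marks with mean \<open>\<tau> u\<close>, this would be the probability that the
  component of \<open>v\<close> contains a mark.\<close>

definition reach :: "nat \<Rightarrow> edge set \<Rightarrow> (nat \<Rightarrow> real) \<Rightarrow> nat \<Rightarrow> real" where
  "reach n E \<tau> v = 1 - exp (- wt n E \<tau> v)"

definition mass :: "nat \<Rightarrow> (nat \<Rightarrow> 'k) \<Rightarrow> edge set \<Rightarrow> (nat \<Rightarrow> real) \<Rightarrow> 'k \<Rightarrow> real" where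
  "mass n ty E \<tau> j = (\<Sum>v | v < n \<and> ty v = j. reach n E \<tau> v) / real n"

text \<open>Up to the factor \<open>n\<close>, summing \<open>pull\<close> over the vertices \<open>u\<close> of type \<open>i\<close> gives the derivative of
  the mass of type \<open>j\<close> in the weight of type \<open>i\<close>.\<close>

definition pull :: "nat \<Rightarrow> (nat \<Rightarrow> 'k) \<Rightarrow> edge set \<Rightarrow> (nat \<Rightarrow> real) \<Rightarrow> 'k \<Rightarrow> nat \<Rightarrow> real" where
  "pull n ty E \<tau> j u = real (card {z \<in> comp n E u. ty z = j}) * exp (- wt n E \<tau> u)"

lemma wt_ge:
  assumes "\<And>u. u < n \<Longrightarrow> \<eta> \<le> \<tau> u"
  shows "\<eta> * real (card (comp n E v)) \<le> wt n E \<tau> v"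
proof -
  have "(\<Sum>u\<in>comp n E v. \<eta>) \<le> wt n E \<tau> v"
    unfolding wt_def by (rule sum_mono) (use assms in \<open>auto simp: mem_comp\<close>)
  then show ?thesis by (simp add: mult.commute)
qed

lemma wt_nonneg:
  assumes "\<And>u. u < n \<Longrightarrow> 0 \<le> \<tau> u"
  shows "0 \<le> wt n E \<tau> v"
  using wt_ge[of n 0 \<tau> E v] assms by simp

lemma reach_bounds:
  assumes "\<And>u. u < n \<Longrightarrow> 0 \<le> \<tau> u"
  shows "0 \<le> reach n E \<tau> v" "reach n E \<tau> v \<le> 1"
  using wt_nonneg[of n \<tau> E v] assms by (auto simp: reach_def)

lemma wt_comp: "u \<in> comp n E v \<Longrightarrow> wt n E \<tau> u = wt n E \<tau> v"
  unfolding wt_def by (simp add: comp_eqI)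

lemma pull_comp: "u \<in> comp n E v \<Longrightarrow> pull n ty E \<tau> j u = pull n ty E \<tau> j v"
  unfolding pull_def by (simp add: comp_eqI wt_comp)

lemma pull_nonneg: "0 \<le> pull n ty E \<tau> j u"
  by (simp add: pull_def)

lemma pull_le_card_exp:
  assumes "\<And>u. u < n \<Longrightarrow> \<eta> \<le> \<tau> u"
  shows "pull n ty E \<tau> j u \<le> real (card (comp n E u)) * exp (- (\<eta> * real (card (comp n E u))))"
  unfolding pull_def using wt_ge[of n \<eta> \<tau> E u] assms
  by (intro mult_mono) (auto intro!: card_mono)

text \<open>By \<open>x \<le> exp x\<close> the exponential beats the component size, so one vertex
  has bounded influence however large its component is.\<close>

lemma pull_le:
  assumes "\<And>u. u < n \<Longrightarrow> \<eta> \<le> \<tau> u" "\<eta> > 0"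
  shows "pull n ty E \<tau> j u \<le> 1 / \<eta>"
proof -
  let ?c = "real (card (comp n E u))"
  have "\<eta> * ?c \<le> exp (\<eta> * ?c)"
    using exp_ge_add_one_self[of "\<eta> * ?c"] by linarith
  then have "?c * exp (- (\<eta> * ?c)) \<le> 1 / \<eta>"
    using assms(2) by (simp add: exp_minus field_simps)
  with pull_le_card_exp[of n \<eta> \<tau> ty E j u] assms(1) show ?thesis by simp
qed

text \<open>The square of \<open>x / 2 \<le> exp (x / 2)\<close>. This pays for pairs inside one
  component, where the product formula for the gain fails.\<close>

lemma card_pull_le:
  assumes "\<And>u. u < n \<Longrightarrow> \<eta> \<le> \<tau> u" "\<eta> > 0"
  shows "real (card (comp n E u)) * pull n ty E \<tau> j u \<le> 4 / \<eta>\<^sup>2"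
proof -
  let ?c = "real (card (comp n E u))"
  have "\<eta> * ?c / 2 \<le> exp (\<eta> * ?c / 2)"
    using exp_ge_add_one_self[of "\<eta> * ?c / 2"] by linarith
  then have "(\<eta> * ?c / 2)\<^sup>2 \<le> (exp (\<eta> * ?c / 2))\<^sup>2"
    using assms(2) by (intro power_mono) auto
  also have "\<dots> = exp (\<eta> * ?c)"
    by (simp flip: exp_double)
  finally have "?c * (?c * exp (- (\<eta> * ?c))) \<le> 4 / \<eta>\<^sup>2"
    using assms(2) by (simp add: exp_minus field_simps power2_eq_square)
  moreover have "?c * pull n ty E \<tau> j u \<le> ?c * (?c * exp (- (\<eta> * ?c)))"
    using pull_le_card_exp[of n \<eta> \<tau> ty E j u] assms(1) by (intro mult_left_mono) auto
  ultimately show ?thesis by linarith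
qed

section \<open>Effect of one new edge on the reach and the mass\<close>

lemma wt_insert:
  assumes "u < n" "v < n" "z < n" "v \<notin> comp n E u"
  shows "wt n (insert {u, v} E) \<tau> z =
    (if z \<in> comp n E u \<union> comp n E v then wt n E \<tau> u + wt n E \<tau> v else wt n E \<tau> z)"
proof -
  have "comp n E u \<inter> comp n E v = {}"
  proof (rule equals0I)
    fix y assume "y \<in> comp n E u \<inter> comp n E v"
    then have "comp n E u = comp n E v" using comp_eqI by (metis IntE)
    then show False using assms comp_self by metis
  qed
  then show ?thesis
    unfolding wt_def using assms by (simp add: comp_insert sum.union_disjoint)
qed

text \<open>Merging adds the weights, and
  \<open>exp (- a) - exp (- (a + b)) = exp (- a) * (1 - exp (- b))\<close>: each side gains
  \<open>exp\<close> of minus its own weight times the reach of the other.\<close>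

lemma reach_insert:
  assumes "u < n" "v < n" "z < n" "v \<notin> comp n E u"
  shows "reach n (insert {u, v} E) \<tau> z - reach n E \<tau> z =
    (if z \<in> comp n E u then exp (- wt n E \<tau> u) * reach n E \<tau> v else 0) +
    (if z \<in> comp n E v then exp (- wt n E \<tau> v) * reach n E \<tau> u else 0)"
proof -
  have "\<not> (z \<in> comp n E u \<and> z \<in> comp n E v)"
    using assms comp_eqI comp_self by metis
  then show ?thesis
    unfolding reach_def wt_insert[OF assms]
    by (auto simp: wt_comp algebra_simps exp_add exp_minus exp_diff field_simps)
qed

definition gain :: "nat \<Rightarrow> (nat \<Rightarrow> 'k) \<Rightarrow> edge set \<Rightarrow> (nat \<Rightarrow> real) \<Rightarrow> 'k \<Rightarrow> edge \<Rightarrow> real" where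
  "gain n ty E \<tau> j e = (\<Sum>z | z < n \<and> ty z = j. reach n (insert e E) \<tau> z - reach n E \<tau> z)"

lemma gain_eq:
  assumes "u < n" "v < n" "v \<notin> comp n E u"
  shows "gain n ty E \<tau> j {u, v} =
    pull n ty E \<tau> j u * reach n E \<tau> v + pull n ty E \<tau> j v * reach n E \<tau> u"
proof -
  have one: "(\<Sum>z | z < n \<and> ty z = j. if z \<in> comp n E u then c else 0) =
      real (card {z \<in> comp n E u. ty z = j}) * c" for u c
  proof -
    have "{z \<in> {z. z < n \<and> ty z = j}. z \<in> comp n E u} = {z \<in> comp n E u. ty z = j}"
      by (auto simp: mem_comp)
    then show ?thesis by (simp flip: sum.inter_filter)
  qed
  show ?thesis
    unfolding gain_def using assms
    by (simp add: reach_insert sum.distrib one pull_def mult_ac)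
qed

lemma gain_loop:
  assumes "u < n" "v < n" "v \<in> comp n E u"
  shows "gain n ty E \<tau> j {u, v} = 0"
proof -
  have "comp n (insert {u, v} E) z = comp n E z" if "z < n" for z
    using that assms comp_insert[of u n v z E] comp_eqI[of v n E u] comp_eqI[of z n E u] by auto
  then show ?thesis by (simp add: gain_def reach_def wt_def)
qed

text \<open>Extends the formula of \<open>gain_eq\<close> to all pairs by a correction for pairs in
  one component, whose true gain is zero. The sum over pairs can then be factorised.\<close>

lemma gain_ge:
  assumes "\<And>u. u < n \<Longrightarrow> 0 \<le> \<tau> u" "u < n" "v < n"
  shows "pull n ty E \<tau> j u * reach n E \<tau> v + pull n ty E \<tau> j v * reach n E \<tau> u
    - (if v \<in> comp n E u then pull n ty E \<tau> j u + pull n ty E \<tau> j v else 0) \<le> gain n ty E \<tau> j {u, v}"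
proof (cases "v \<in> comp n E u")
  case True
  have "pull n ty E \<tau> j u * reach n E \<tau> v \<le> pull n ty E \<tau> j u * 1"
    "pull n ty E \<tau> j v * reach n E \<tau> u \<le> pull n ty E \<tau> j v * 1"
    by (intro mult_left_mono reach_bounds assms pull_nonneg; simp)+
  with True assms show ?thesis by (simp add: gain_loop)
qed (use assms in \<open>simp add: gain_eq\<close>)

lemma gain_bounds:
  assumes "\<And>u. u < n \<Longrightarrow> \<eta> \<le> \<tau> u" "\<eta> > 0" "u < n" "v < n"
  shows "0 \<le> gain n ty E \<tau> j {u, v}" "gain n ty E \<tau> j {u, v} \<le> 2 / \<eta>"
proof -
  have nn: "\<And>u. u < n \<Longrightarrow> 0 \<le> \<tau> u"
    using assms(1,2) by (meson less_le_not_le order_trans)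
  have le: "pull n ty E \<tau> j u * reach n E \<tau> v \<le> 1 / \<eta> * 1" for u v
    by (intro mult_mono pull_le assms reach_bounds nn pull_nonneg) (use assms(2) in auto)
  have ge: "0 \<le> pull n ty E \<tau> j u * reach n E \<tau> v" for u v
    by (intro mult_nonneg_nonneg pull_nonneg reach_bounds nn)
  show "0 \<le> gain n ty E \<tau> j {u, v}"
    using assms ge[of u v] ge[of v u] by (cases "v \<in> comp n E u") (simp_all add: gain_eq gain_loop)
  show "gain n ty E \<tau> j {u, v} \<le> 2 / \<eta>"
    using assms le[of u v] le[of v u] by (cases "v \<in> comp n E u") (simp_all add: gain_eq gain_loop)
qed

subsection \<open>The expected change of the potential\<close>

text \<open>An edge is an unordered set, so the condition is imposed on both orders of its
  endpoints; for symmetric \<open>A\<close> these agree.\<close>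

definition permitted :: "(nat \<Rightarrow> 'k) \<Rightarrow> ('k \<Rightarrow> 'k \<Rightarrow> bool) \<Rightarrow> edge \<Rightarrow> bool" where
  "permitted ty A e \<longleftrightarrow> (\<forall>u\<in>e. \<forall>v\<in>e. u \<noteq> v \<longrightarrow> A (ty u) (ty v))"

lemma permitted_pair:
  assumes "symp A" "u \<noteq> v"
  shows "permitted ty A {u, v} \<longleftrightarrow> A (ty u) (ty v)"
  using assms by (auto simp: permitted_def dest: sympD)

lemma sum_by_type:
  fixes ty :: "nat \<Rightarrow> 'k::finite" and f :: "nat \<Rightarrow> real"
  shows "(\<Sum>v<n. of_bool (A (ty v)) * f v) = (\<Sum>a\<in>UNIV. of_bool (A a) * (\<Sum>v | v < n \<and> ty v = a. f v))"
    (is "_ = ?r")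
proof -
  have "?r = (\<Sum>a\<in>UNIV. \<Sum>v\<in>{v \<in> {..<n}. ty v = a}. of_bool (A (ty v)) * f v)"
    by (auto simp: sum_distrib_left intro!: sum.cong)
  also have "\<dots> = (\<Sum>v<n. of_bool (A (ty v)) * f v)"
    by (rule sum.group) auto
  finally show ?thesis by simp
qed

text \<open>By symmetry of \<open>A\<close> the two products in the gain have equal sums, which
  gives the factor 2, and summing over the partner of \<open>u\<close> leaves masses of types. The
  error term pays for pairs inside one component.\<close>

lemma sum_gain_ge:
  fixes ty :: "nat \<Rightarrow> 'k::finite"
  assumes \<tau>: "\<And>u. u < n \<Longrightarrow> \<eta> \<le> \<tau> u" and \<eta>: "\<eta> > 0" and A: "symp A" and n: "n \<ge> 2"
  shows "2 * real n * (\<Sum>u<n. pull n ty E \<tau> j u * (\<Sum>a\<in>UNIV. of_bool (A a (ty u)) * mass n ty E \<tau> a))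
      - 8 * real n / \<eta>\<^sup>2
    \<le> (\<Sum>u<n. \<Sum>v\<in>{..<n} - {u}. of_bool (A (ty u) (ty v)) * gain n ty E \<tau> j {u, v})"
proof -
  let ?p = "pull n ty E \<tau> j" and ?r = "reach n E \<tau>"
  let ?B = "\<lambda>u v. of_bool (A (ty u) (ty v)) * (?p u * ?r v + ?p v * ?r u)
    - (if v \<in> comp n E u then 2 * ?p u else 0)"
  have nn: "\<And>u. u < n \<Longrightarrow> 0 \<le> \<tau> u"
    using \<tau> \<eta> by (meson less_le_not_le order_trans)
  have sym: "A a b \<longleftrightarrow> A b a" for a b
    using A by (auto dest: sympD)
  have pn: "0 \<le> ?p u" for u by (rule pull_nonneg)
  have B: "?B u v \<le> of_bool (A (ty u) (ty v)) * gain n ty E \<tau> j {u, v}"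
    if "u < n" "v < n" for u v
    using gain_ge[of n \<tau> u v ty E j, OF nn that] pn[of u] by (auto simp: pull_comp)
  \<comment> \<open>Adding the diagonal only lowers the sum: \<open>u\<close> lies in its own
    component, so the correction outweighs the products. The full double sum then
    factorises.\<close>
  have diag: "?B u u \<le> 0" if "u < n" for u
  proof -
    have "?p u * ?r u \<le> ?p u * 1" by (intro mult_left_mono reach_bounds nn pn; simp)
    then show ?thesis using that pn[of u] by (auto simp: comp_self mult.commute[of "?r u"])
  qed
  have "(\<Sum>u<n. \<Sum>v<n. ?B u v) \<le> (\<Sum>u<n. \<Sum>v\<in>{..<n} - {u}. ?B u v)"
  proof (rule sum_mono)
    fix u assume "u \<in> {..<n}"
    then have "(\<Sum>v<n. ?B u v) = ?B u u + (\<Sum>v\<in>{..<n} - {u}. ?B u v)"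
      by (intro sum.remove) auto
    with diag[of u] \<open>u \<in> {..<n}\<close> show "(\<Sum>v<n. ?B u v) \<le> (\<Sum>v\<in>{..<n} - {u}. ?B u v)" by simp
  qed
  also have "\<dots> \<le> (\<Sum>u<n. \<Sum>v\<in>{..<n} - {u}. of_bool (A (ty u) (ty v)) * gain n ty E \<tau> j {u, v})"
    by (intro sum_mono B) auto
  finally have le: "(\<Sum>u<n. \<Sum>v<n. ?B u v) \<le> \<dots>" .
  have "(\<Sum>u<n. \<Sum>v<n. of_bool (A (ty u) (ty v)) * (?p v * ?r u)) =
      (\<Sum>u<n. \<Sum>v<n. of_bool (A (ty u) (ty v)) * (?p u * ?r v))"
    by (subst sum.swap) (simp add: sym)
  moreover have "(\<Sum>u<n. \<Sum>v<n. of_bool (A (ty u) (ty v)) * (?p u * ?r v)) =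
      real n * (\<Sum>u<n. ?p u * (\<Sum>a\<in>UNIV. of_bool (A a (ty u)) * mass n ty E \<tau> a))"
  proof -
    have "(\<Sum>v<n. of_bool (A (ty u) (ty v)) * (?p u * ?r v)) =
        real n * (?p u * (\<Sum>a\<in>UNIV. of_bool (A a (ty u)) * mass n ty E \<tau> a))" for u
    proof -
      have "(\<Sum>v<n. of_bool (A (ty u) (ty v)) * (?p u * ?r v)) =
          ?p u * (\<Sum>v<n. of_bool (A (ty v) (ty u)) * ?r v)"
        unfolding sum_distrib_left sym[of "ty u"] by (intro sum.cong refl) (simp only: mult_ac)
      also have "(\<Sum>v<n. of_bool (A (ty v) (ty u)) * ?r v) =
          real n * (\<Sum>a\<in>UNIV. of_bool (A a (ty u)) * mass n ty E \<tau> a)"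
        unfolding sum_by_type[of "\<lambda>a. A a (ty u)"] sum_distrib_left
        using n by (intro sum.cong refl) (simp add: mass_def)
      finally show ?thesis by simp
    qed
    then show ?thesis by (simp add: sum_distrib_left)
  qed
  moreover have "(\<Sum>u<n. \<Sum>v<n. (if v \<in> comp n E u then 2 * ?p u else 0)) \<le> 8 * real n / \<eta>\<^sup>2"
  proof -
    have "(\<Sum>v<n. (if v \<in> comp n E u then 2 * ?p u else 0)) \<le> 8 / \<eta>\<^sup>2" for u
    proof -
      have "{v \<in> {..<n}. v \<in> comp n E u} = comp n E u"
        using comp_subset[of n E u] by auto
      then have "(\<Sum>v<n. (if v \<in> comp n E u then 2 * ?p u else 0)) = 2 * (real (card (comp n E u)) * ?p u)"
        by (simp flip: sum.inter_filter)
      then show ?thesis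
        using card_pull_le[of n \<eta> \<tau> E u ty j, OF \<tau> \<eta>] by simp
    qed
    then have "(\<Sum>u<n. \<Sum>v<n. (if v \<in> comp n E u then 2 * ?p u else 0)) \<le> (\<Sum>u<n. 8 / \<eta>\<^sup>2)"
      by (intro sum_mono) auto
    then show ?thesis by (simp add: mult.commute)
  qed
  ultimately show ?thesis
    using le by (simp add: sum.distrib sum_subtractf distrib_left)
qed

text \<open>The mass is concave in the weights, so it lies below its tangent at \<open>\<tau>\<close>.\<close>

lemma mass_drop:
  fixes ty :: "nat \<Rightarrow> 'k"
  shows "mass n ty E (\<lambda>u. \<tau> u + \<delta> u) j - (\<Sum>u<n. \<delta> u * pull n ty E \<tau> j u) / real n \<le> mass n ty E \<tau> j"
proof -
  let ?J = "{z. z < n \<and> ty z = j}"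
  have wt: "wt n E (\<lambda>u. \<tau> u + \<delta> u) z = wt n E \<tau> z + (\<Sum>u\<in>comp n E z. \<delta> u)" for z
    by (simp add: wt_def sum.distrib)
  have conv: "reach n E (\<lambda>u. \<tau> u + \<delta> u) z - (\<Sum>u\<in>comp n E z. \<delta> u * exp (- wt n E \<tau> z)) \<le> reach n E \<tau> z" for z
  proof -
    let ?d = "\<Sum>u\<in>comp n E z. \<delta> u" and ?w = "wt n E \<tau> z"
    have "exp (- ?w) * (1 - ?d) \<le> exp (- ?w) * exp (- ?d)"
      using exp_ge_add_one_self[of "- ?d"] by (intro mult_left_mono) auto
    then show ?thesis
      unfolding reach_def wt sum_distrib_right[symmetric]
      by (simp add: exp_add[symmetric] algebra_simps)
  qed
  \<comment> \<open>Double counting of pairs in a common component: the derivative is collected at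
    the vertex \<open>u\<close> whose weight changes, where it becomes \<open>pull\<close>.\<close>
  have "(\<Sum>z\<in>?J. \<Sum>u\<in>comp n E z. \<delta> u * exp (- wt n E \<tau> z)) =
      (\<Sum>z\<in>?J. \<Sum>u\<in>{u \<in> {..<n}. u \<in> comp n E z}. \<delta> u * exp (- wt n E \<tau> z))"
    using comp_subset[of n E] by (intro sum.cong refl) auto
  also have "\<dots> = (\<Sum>u<n. \<Sum>z\<in>{z \<in> ?J. u \<in> comp n E z}. \<delta> u * exp (- wt n E \<tau> z))"
    by (rule sum.swap_restrict) auto
  also have "\<dots> = (\<Sum>u<n. \<Sum>z\<in>{z \<in> comp n E u. ty z = j}. \<delta> u * exp (- wt n E \<tau> u))"
  proof (intro sum.cong refl)
    fix u assume "u \<in> {..<n}"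
    then show "{z \<in> ?J. u \<in> comp n E z} = {z \<in> comp n E u. ty z = j}"
      using comp_sym[of _ n u E] comp_sym[of u n _ E] by (auto simp: mem_comp)
  next
    fix u z assume "z \<in> {z \<in> comp n E u. ty z = j}"
    then show "\<delta> u * exp (- wt n E \<tau> z) = \<delta> u * exp (- wt n E \<tau> u)"
      by (simp add: wt_comp)
  qed
  also have "\<dots> = (\<Sum>u<n. \<delta> u * pull n ty E \<tau> j u)"
    by (simp add: pull_def mult_ac)
  finally have swap: "(\<Sum>z\<in>?J. \<Sum>u\<in>comp n E z. \<delta> u * exp (- wt n E \<tau> z)) = \<dots>" .
  have "(\<Sum>z\<in>?J. reach n E (\<lambda>u. \<tau> u + \<delta> u) z - (\<Sum>u\<in>comp n E z. \<delta> u * exp (- wt n E \<tau> z)))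
      \<le> (\<Sum>z\<in>?J. reach n E \<tau> z)"
    by (intro sum_mono conv)
  then have "(\<Sum>z\<in>?J. reach n E (\<lambda>u. \<tau> u + \<delta> u) z) - (\<Sum>u<n. \<delta> u * pull n ty E \<tau> j u)
      \<le> (\<Sum>z\<in>?J. reach n E \<tau> z)"
    by (simp add: sum_subtractf swap)
  then show ?thesis
    unfolding mass_def diff_divide_distrib[symmetric] by (intro divide_right_mono) auto
qed

lemma mass_insert: "mass n ty (insert e E) \<tau> j = mass n ty E \<tau> j + gain n ty E \<tau> j e / real n"
  by (simp add: mass_def gain_def sum_subtractf add_divide_distrib[symmetric])

lemma mass_nonneg:
  assumes "\<And>u. u < n \<Longrightarrow> 0 \<le> \<tau> u"
  shows "0 \<le> mass n ty E \<tau> j"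
  unfolding mass_def by (intro divide_nonneg_nonneg sum_nonneg reach_bounds assms) auto

lemma mass_mono:
  assumes "\<And>u v. v < n \<Longrightarrow> ty v = j \<Longrightarrow> u \<in> comp n E v \<Longrightarrow> \<tau> u \<le> \<tau>' u"
  shows "mass n ty E \<tau> j \<le> mass n ty E \<tau>' j"
proof -
  have "wt n E \<tau> v \<le> wt n E \<tau>' v" if "v < n" "ty v = j" for v
    unfolding wt_def using assms[OF that] by (rule sum_mono)
  then show ?thesis
    unfolding mass_def reach_def by (intro divide_right_mono sum_mono) auto
qed

definition extend :: "(nat \<Rightarrow> 'k) \<Rightarrow> ('k \<Rightarrow> 'k \<Rightarrow> bool) \<Rightarrow> edge \<Rightarrow> edge set \<Rightarrow> edge set" where
  "extend ty A e E = (if permitted ty A e then insert e E else E)"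

text \<open>Only shortfalls count, since exceeding \<open>b\<close> is welcome. With squares,
  increments of order \<open>1 / n\<close> enter linearly only through their mean, and their
  fluctuations cost order \<open>1 / n\<^sup>2\<close>.\<close>

definition deficit :: "nat \<Rightarrow> (nat \<Rightarrow> 'k::finite) \<Rightarrow> ('k \<Rightarrow> real) \<Rightarrow> edge set \<Rightarrow> (nat \<Rightarrow> real) \<Rightarrow> real" where
  "deficit n ty b E \<tau> = (\<Sum>j\<in>UNIV. (max 0 (b j - mass n ty E \<tau> j))\<^sup>2)"

text \<open>The coefficient of \<open>1 / n\<^sup>2\<close> in one round, summed over
  \<open>K\<close> types: first the error in the expected increment, then the squared size of an
  increment.\<close>

definition drift_const :: "real \<Rightarrow> real \<Rightarrow> real" where
  "drift_const K \<eta> = 2 * K * (4 * K\<^sup>2 / \<eta>\<^sup>2 + 16 / \<eta>\<^sup>2) + K * ((2 * K + 2) / \<eta>)\<^sup>2"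

lemma drift_const_nonneg: "K \<ge> 0 \<Longrightarrow> drift_const K \<eta> \<ge> 0"
  by (simp add: drift_const_def)

text \<open>Replaces the truncated square by a polynomial in \<open>d\<close>, so that only the mean
  and the maximal size of a random increment \<open>d\<close> have to be known.\<close>

lemma neg_part_square_le: "(max 0 (x - d))\<^sup>2 \<le> (max 0 x)\<^sup>2 - 2 * max 0 x * d + (d::real)\<^sup>2"
proof -
  have "max 0 (x - d) \<le> \<bar>max 0 x - d\<bar>" by linarith
  then have "(max 0 (x - d))\<^sup>2 \<le> \<bar>max 0 x - d\<bar>\<^sup>2" by (intro power_mono) auto
  then show ?thesis by (simp add: power2_diff)
qed

text \<open>The loss from decreasing the weights and the gain from the new edge are both taken at the
  decreased weights, where they cancel up to \<open>b - mass\<close>.\<close>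

lemma deficit_step:
  fixes ty :: "nat \<Rightarrow> 'k::finite" and \<theta> :: "'k \<Rightarrow> real"
  assumes n: "n \<ge> 2" and A: "symp A" and \<eta>: "\<eta> > 0" and \<theta>: "\<And>i. \<eta> \<le> \<theta> i"
    and b: "\<And>i. 0 \<le> b i" "\<And>i. b i \<le> 1"
  defines "K \<equiv> real (CARD('k))"
    and "\<delta> \<equiv> \<lambda>i. 2 / real n * (\<Sum>a\<in>UNIV. of_bool (A a i) * b a)"
  shows "measure_pmf.expectation (pmf_of_set (all_edges n)) (\<lambda>e. deficit n ty b (extend ty A e E) (\<lambda>u. \<theta> (ty u)))
    \<le> (1 + 4 * K / (\<eta> * n)) * deficit n ty b E (\<lambda>u. \<theta> (ty u) + \<delta> (ty u)) + drift_const K \<eta> / (real n)\<^sup>2"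
proof -
  let ?E = "measure_pmf.expectation (pmf_of_set (all_edges n))"
  define \<tau> where "\<tau> = (\<lambda>u. \<theta> (ty u))"
  define m0 where "m0 = mass n ty E (\<lambda>u. \<tau> u + \<delta> (ty u))"
  define m where "m = mass n ty E \<tau>"
  define p where "p = pull n ty E \<tau>"
  define y where "y j = max 0 (b j - m0 j)" for j
  define Y where "Y = (\<Sum>j\<in>UNIV. y j)"
  define D where "D j e = mass n ty (extend ty A e E) \<tau> j - m0 j" for j e
  have K: "K \<ge> 0" by (simp add: K_def)
  have npos: "real n > 0" using n by simp
  have \<tau>: "\<And>u. \<eta> \<le> \<tau> u" using \<theta> by (simp add: \<tau>_def)
  have nn: "\<And>u. 0 \<le> \<tau> u" using \<tau> \<eta> by (meson less_le_not_le order_trans)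
  have pn: "0 \<le> p j u" for j u by (simp add: p_def pull_nonneg)
  have p_le: "p j u \<le> 1 / \<eta>" for j u
    unfolding p_def by (rule pull_le) (use \<tau> \<eta> in auto)
  have Ab: "0 \<le> (\<Sum>a\<in>UNIV. of_bool (A a i) * b a)" "(\<Sum>a\<in>UNIV. of_bool (A a i) * b a) \<le> K" for i
  proof -
    show "0 \<le> (\<Sum>a\<in>UNIV. of_bool (A a i) * b a)" by (intro sum_nonneg) (use b in auto)
    have "(\<Sum>a\<in>UNIV. of_bool (A a i) * b a) \<le> (\<Sum>a\<in>(UNIV :: 'k set). 1)"
      by (intro sum_mono) (use b in auto)
    then show "(\<Sum>a\<in>UNIV. of_bool (A a i) * b a) \<le> K" by (simp add: K_def)
  qed
  have \<delta>: "0 \<le> \<delta> i" "\<delta> i \<le> 2 * K / n" for i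
    using Ab[of i] npos by (auto simp: \<delta>_def field_simps)
  have drop: "m0 j - (\<Sum>u<n. \<delta> (ty u) * p j u) / n \<le> m j" for j
    unfolding m0_def m_def p_def by (rule mass_drop)
  have sum_le: "(\<Sum>u<n. \<delta> (ty u) * p j u) / n \<le> 2 * K / (\<eta> * n)" for j
  proof -
    have "(\<Sum>u<n. \<delta> (ty u) * p j u) \<le> (\<Sum>u<n. 2 * K / n * (1 / \<eta>))"
      by (intro sum_mono mult_mono \<delta> p_le pn) (use K in simp)
    also have "\<dots> = 2 * K / \<eta>" using npos by simp
    finally show ?thesis using npos \<eta> by (simp add: field_simps)
  qed
  have m_ge: "m0 j - 2 * K / (\<eta> * n) \<le> m j" for j
    using drop[of j] sum_le[of j] by linarith
  have m_le: "m j \<le> m0 j" for j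
    unfolding m_def m0_def by (rule mass_mono) (use \<delta> in simp)
  have m0_nonneg: "0 \<le> m0 j" for j
    unfolding m0_def by (rule mass_nonneg) (use nn \<delta> in \<open>simp add: add_nonneg_nonneg\<close>)
  have y: "0 \<le> y j" "y j \<le> 1" for j
    using b(2)[of j] m0_nonneg[of j] by (auto simp: y_def)
  have Y: "0 \<le> Y" "Y \<le> K"
  proof -
    show "0 \<le> Y" by (simp add: Y_def sum_nonneg y)
    have "Y \<le> (\<Sum>j\<in>(UNIV :: 'k set). 1)" unfolding Y_def by (intro sum_mono y)
    then show "Y \<le> K" by (simp add: K_def)
  qed
  have D_eq: "D j {u, v} = (m j - m0 j) + of_bool (A (ty u) (ty v)) * gain n ty E \<tau> j {u, v} / n"
    if "u \<noteq> v" for j u v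
    using that by (simp add: D_def extend_def permitted_pair[OF A] m_def mass_insert)
  \<comment> \<open>Lowering the weights costs at most \<open>2 * K / (\<eta> * n)\<close> and a new
    edge adds at most \<open>2 / (\<eta> * n)\<close>.\<close>
  have D_bound: "\<bar>D j e\<bar> \<le> (2 * K + 2) / (\<eta> * n)" if e_in: "e \<in> all_edges n" for j e
  proof -
    obtain u v where e: "e = {u, v}" "u < n" "v < n" "u \<noteq> v"
      using e_in unfolding all_edges_def by (elim nsets2_E) auto
    have "0 \<le> gain n ty E \<tau> j e" "gain n ty E \<tau> j e \<le> 2 / \<eta>"
      unfolding e(1) by (rule gain_bounds[of n \<eta> \<tau>, OF \<tau> \<eta> e(2,3)])+
    then have g: "0 \<le> gain n ty E \<tau> j e / n" "gain n ty E \<tau> j e / n \<le> 2 / (\<eta> * n)"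
      using npos \<eta> by (auto simp: field_simps)
    have "(2 * K + 2) / (\<eta> * n) = 2 * K / (\<eta> * n) + 2 / (\<eta> * n)" by (simp add: add_divide_distrib)
    moreover have "0 \<le> 2 * K / (\<eta> * n)" "0 \<le> 2 / (\<eta> * n)" using K \<eta> by auto
    moreover have "D j e = m j - m0 j \<or> D j e = m j - m0 j + gain n ty E \<tau> j e / n"
      using D_eq[OF e(4), of j] e(1) by auto
    ultimately show ?thesis using g m_le[of j] m_ge[of j] by linarith
  qed
  \<comment> \<open>\<open>T\<close> measures the loss from the lower weights and \<open>S\<close>
    the mean gain from the edge. They differ only in \<open>b\<close> versus \<open>m\<close>, and
    \<open>b - m\<close> is at most the shortfall \<open>y\<close> plus order \<open>1 / n\<close>;
    this is the cancellation along the characteristic.\<close>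
  have ED: "- (2 / (\<eta> * n)) * Y - (4 * K\<^sup>2 / \<eta>\<^sup>2 + 16 / \<eta>\<^sup>2) / n\<^sup>2 \<le> ?E (D j)" for j
  proof -
    define S where "S = (\<Sum>u<n. p j u * (\<Sum>a\<in>UNIV. of_bool (A a (ty u)) * m a))"
    define T where "T = (\<Sum>u<n. p j u * (\<Sum>a\<in>UNIV. of_bool (A a (ty u)) * b a))"
    define G where "G = (\<Sum>u<n. \<Sum>v\<in>{..<n} - {u}. of_bool (A (ty u) (ty v)) * gain n ty E \<tau> j {u, v})"
    have m_nonneg: "0 \<le> m a" for a unfolding m_def by (rule mass_nonneg) (rule nn)
    have S0: "0 \<le> S"
      unfolding S_def by (intro sum_nonneg mult_nonneg_nonneg pn m_nonneg) auto
    have "?E (D j) = (\<Sum>u<n. \<Sum>v\<in>{..<n} - {u}. D j {u, v}) / (real n * (real n - 1))"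
      by (rule expectation_edge[OF n])
    also have "(\<Sum>u<n. \<Sum>v\<in>{..<n} - {u}. D j {u, v}) =
        (\<Sum>u<n. \<Sum>v\<in>{..<n} - {u}. (m j - m0 j) + of_bool (A (ty u) (ty v)) * gain n ty E \<tau> j {u, v} / n)"
      by (intro sum.cong refl D_eq) auto
    also have "\<dots> = real n * (real n - 1) * (m j - m0 j) + G / n"
      unfolding G_def sum_divide_distrib sum.distrib using n by (simp add: of_nat_diff)
    also have "\<dots> / (real n * (real n - 1)) = m j - m0 j + G / (real n * (real n * (real n - 1)))"
      using n by (simp add: field_simps)
    finally have ED: "?E (D j) = \<dots>" .
    have "2 * real n * S - 8 * real n / \<eta>\<^sup>2 \<le> G"
      unfolding S_def G_def m_def p_def by (intro sum_gain_ge \<tau> \<eta> A n)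
    then have "(2 * real n * S - 8 * real n / \<eta>\<^sup>2) / (real n * (real n * (real n - 1)))
        \<le> G / (real n * (real n * (real n - 1)))"
      using n by (intro divide_right_mono) auto
    moreover have "(2 * real n * S - 8 * real n / \<eta>\<^sup>2) / (real n * (real n * (real n - 1))) =
        2 * S / (real n * (real n - 1)) - 8 / \<eta>\<^sup>2 / (real n * (real n - 1))"
      using n by (simp add: diff_divide_distrib)
    moreover have "2 * S / n\<^sup>2 \<le> 2 * S / (real n * (real n - 1))"
      using n S0 by (intro divide_left_mono) (auto simp: power2_eq_square)
    moreover have "8 / \<eta>\<^sup>2 / (real n * (real n - 1)) \<le> 16 / \<eta>\<^sup>2 / n\<^sup>2"
    proof -
      have "8 / \<eta>\<^sup>2 / (real n * (real n - 1)) \<le> 8 / \<eta>\<^sup>2 / ((real n)\<^sup>2 / 2)"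
        using n by (intro divide_left_mono) (auto simp: power2_eq_square field_simps)
      then show ?thesis by simp
    qed
    ultimately have G: "2 * S / n\<^sup>2 - 16 / \<eta>\<^sup>2 / n\<^sup>2 \<le> G / (real n * (real n * (real n - 1)))"
      by linarith
    have "(\<Sum>u<n. \<delta> (ty u) * p j u) / n = 2 * T / n\<^sup>2"
      by (simp add: \<delta>_def T_def sum_distrib_left sum_divide_distrib power2_eq_square mult_ac)
    then have dr: "m0 j - 2 * T / n\<^sup>2 \<le> m j" using drop[of j] by simp
    have "T - S \<le> n * (1 / \<eta> * (Y + K * (2 * K / (\<eta> * n))))"
    proof -
      have "T - S = (\<Sum>u<n. p j u * (\<Sum>a\<in>UNIV. of_bool (A a (ty u)) * (b a - m a)))"
        by (simp add: T_def S_def sum_subtractf right_diff_distrib)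
      also have "\<dots> \<le> (\<Sum>u<n. 1 / \<eta> * (Y + K * (2 * K / (\<eta> * n))))"
      proof (intro sum_mono)
        fix u
        have "(\<Sum>a\<in>UNIV. of_bool (A a (ty u)) * (b a - m a)) \<le> (\<Sum>a\<in>UNIV. y a + 2 * K / (\<eta> * n))"
        proof (intro sum_mono)
          fix a
          have "b a - m a \<le> y a + 2 * K / (\<eta> * n)" using m_ge[of a] by (simp add: y_def)
          moreover have "0 \<le> y a + 2 * K / (\<eta> * n)" using y K \<eta> by simp
          ultimately show "of_bool (A a (ty u)) * (b a - m a) \<le> y a + 2 * K / (\<eta> * n)" by simp
        qed
        also have "\<dots> = Y + K * (2 * K / (\<eta> * n))" by (simp add: sum.distrib Y_def K_def)
        finally have "p j u * (\<Sum>a\<in>UNIV. of_bool (A a (ty u)) * (b a - m a)) \<le> p j u * (Y + K * (2 * K / (\<eta> * n)))"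
          by (intro mult_left_mono pn)
        also have "\<dots> \<le> 1 / \<eta> * (Y + K * (2 * K / (\<eta> * n)))"
          by (intro mult_right_mono p_le) (use Y K \<eta> in auto)
        finally show "p j u * (\<Sum>a\<in>UNIV. of_bool (A a (ty u)) * (b a - m a)) \<le> \<dots>" .
      qed
      finally show ?thesis by simp
    qed
    then have "2 * (T - S) / n\<^sup>2 \<le> 2 * (n * (1 / \<eta> * (Y + K * (2 * K / (\<eta> * n))))) / n\<^sup>2"
      by (intro divide_right_mono) auto
    also have "\<dots> = 2 / (\<eta> * n) * Y + 4 * K\<^sup>2 / \<eta>\<^sup>2 / n\<^sup>2"
      using npos \<eta> by (simp add: field_simps power2_eq_square)
    finally have "2 * T / n\<^sup>2 - 2 * S / n\<^sup>2 \<le> 2 / (\<eta> * n) * Y + 4 * K\<^sup>2 / \<eta>\<^sup>2 / n\<^sup>2"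
      by (simp add: right_diff_distrib diff_divide_distrib)
    then show ?thesis
      using ED G dr by (simp add: add_divide_distrib)
  qed
  have fin: "integrable (measure_pmf (pmf_of_set (all_edges n))) f" for f :: "edge \<Rightarrow> real"
    by (rule integrable_measure_pmf_finite) (use n in simp)
  have one: "?E (\<lambda>e. (max 0 (b j - mass n ty (extend ty A e E) \<tau> j))\<^sup>2) \<le>
      (y j)\<^sup>2 + 4 / (\<eta> * n) * (y j * Y) + (2 * (4 * K\<^sup>2 / \<eta>\<^sup>2 + 16 / \<eta>\<^sup>2) + ((2 * K + 2) / \<eta>)\<^sup>2) / n\<^sup>2" for j
  proof -
    define c where "c = 4 * K\<^sup>2 / \<eta>\<^sup>2 + 16 / \<eta>\<^sup>2"
    have c: "c \<ge> 0" by (simp add: c_def)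
    have "?E (\<lambda>e. (max 0 (b j - mass n ty (extend ty A e E) \<tau> j))\<^sup>2) \<le>
        ?E (\<lambda>e. ((y j)\<^sup>2 + ((2 * K + 2) / (\<eta> * n))\<^sup>2) - 2 * y j * D j e)"
    proof (rule integral_mono_AE[OF fin fin], rule AE_pmfI)
      fix e assume "e \<in> set_pmf (pmf_of_set (all_edges n))"
      then have e: "e \<in> all_edges n" using n by simp
      have "(max 0 (b j - mass n ty (extend ty A e E) \<tau> j))\<^sup>2 = (max 0 (b j - m0 j - D j e))\<^sup>2"
        by (simp add: D_def)
      also have "\<dots> \<le> (y j)\<^sup>2 - 2 * y j * D j e + (D j e)\<^sup>2"
        unfolding y_def by (rule neg_part_square_le)
      also have "(D j e)\<^sup>2 \<le> ((2 * K + 2) / (\<eta> * n))\<^sup>2"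
        using power_mono[OF D_bound[OF e, of j], of 2] by simp
      finally show "(max 0 (b j - mass n ty (extend ty A e E) \<tau> j))\<^sup>2 \<le>
          ((y j)\<^sup>2 + ((2 * K + 2) / (\<eta> * n))\<^sup>2) - 2 * y j * D j e" by linarith
    qed
    also have "\<dots> = (y j)\<^sup>2 + ((2 * K + 2) / (\<eta> * n))\<^sup>2 - 2 * y j * ?E (D j)"
      by (subst Bochner_Integration.integral_diff[OF fin fin]) simp
    also have "\<dots> \<le> (y j)\<^sup>2 + ((2 * K + 2) / (\<eta> * n))\<^sup>2 + 2 * y j * (2 / (\<eta> * n) * Y + c / n\<^sup>2)"
    proof -
      have "2 * y j * (- (2 / (\<eta> * n)) * Y - c / n\<^sup>2) \<le> 2 * y j * ?E (D j)"
        using ED[of j] y(1)[of j] unfolding c_def by (intro mult_left_mono) auto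
      then show ?thesis by (simp add: algebra_simps)
    qed
    also have "\<dots> = (y j)\<^sup>2 + 4 / (\<eta> * n) * (y j * Y) + ((2 * K + 2) / \<eta>)\<^sup>2 / n\<^sup>2 + y j * (2 * c / n\<^sup>2)"
      using npos \<eta> by (simp add: field_simps power2_eq_square)
    also have "y j * (2 * c / n\<^sup>2) \<le> 1 * (2 * c / n\<^sup>2)"
      using y c by (intro mult_right_mono) auto
    finally show ?thesis by (simp add: c_def add_divide_distrib)
  qed
  have "?E (\<lambda>e. deficit n ty b (extend ty A e E) \<tau>) =
      (\<Sum>j\<in>UNIV. ?E (\<lambda>e. (max 0 (b j - mass n ty (extend ty A e E) \<tau> j))\<^sup>2))"
    unfolding deficit_def by (rule Bochner_Integration.integral_sum) (rule fin)
  also have "\<dots> \<le> (\<Sum>j\<in>UNIV. (y j)\<^sup>2 + 4 / (\<eta> * n) * (y j * Y) +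
      (2 * (4 * K\<^sup>2 / \<eta>\<^sup>2 + 16 / \<eta>\<^sup>2) + ((2 * K + 2) / \<eta>)\<^sup>2) / n\<^sup>2)"
    by (intro sum_mono one)
  also have "\<dots> = (\<Sum>j\<in>UNIV. (y j)\<^sup>2) + 4 / (\<eta> * n) * Y\<^sup>2 + drift_const K \<eta> / n\<^sup>2"
  proof -
    have "(\<Sum>j\<in>UNIV. 4 / (\<eta> * n) * (y j * Y)) = 4 / (\<eta> * n) * Y\<^sup>2"
      unfolding sum_distrib_left[symmetric] sum_distrib_right[symmetric] Y_def[symmetric] power2_eq_square ..
    then show ?thesis
      by (simp add: sum.distrib K_def[symmetric] drift_const_def algebra_simps add_divide_distrib)
  qed
  \<comment> \<open>Cauchy-Schwarz over the \<open>K\<close> types turns the square of the total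
    shortfall back into \<open>deficit\<close>, which closes the recursion.\<close>
  also have "\<dots> \<le> (\<Sum>j\<in>UNIV. (y j)\<^sup>2) + 4 / (\<eta> * n) * (K * (\<Sum>j\<in>UNIV. (y j)\<^sup>2)) + drift_const K \<eta> / n\<^sup>2"
  proof (intro add_mono order_refl mult_left_mono)
    show "Y\<^sup>2 \<le> K * (\<Sum>j\<in>UNIV. (y j)\<^sup>2)"
      using Cauchy_Schwarz_ineq_sum[of y "\<lambda>_. 1" UNIV] by (simp add: Y_def K_def mult.commute)
  qed (use \<eta> in simp)
  also have "(\<Sum>j\<in>UNIV. (y j)\<^sup>2) = deficit n ty b E (\<lambda>u. \<theta> (ty u) + \<delta> (ty u))"
    by (simp add: deficit_def y_def m0_def \<tau>_def)
  finally show ?thesis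
    using npos \<eta> by (simp add: \<tau>_def algebra_simps)
qed

subsection \<open>Concentration along a phase\<close>

lemma expectation_bind_finite:
  fixes h :: "'b \<Rightarrow> real"
  assumes "finite (set_pmf p)" "\<And>x. x \<in> set_pmf p \<Longrightarrow> finite (set_pmf (f x))"
  shows "measure_pmf.expectation (bind_pmf p f) h =
    measure_pmf.expectation p (\<lambda>x. measure_pmf.expectation (f x) h)"
proof -
  have "measure_pmf.expectation (bind_pmf p f) h =
      (\<Sum>a\<in>set_pmf p. pmf p a *\<^sub>R measure_pmf.expectation (f a) h)"
    by (rule pmf_expectation_bind[OF assms order_refl])
  also have "\<dots> = measure_pmf.expectation p (\<lambda>x. measure_pmf.expectation (f x) h)"
    by (rule integral_measure_pmf[OF assms(1), symmetric])
  finally show ?thesis .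
qed

lemma finite_set_replicate_pmf: "finite (set_pmf p) \<Longrightarrow> finite (set_pmf (replicate_pmf m p))"
  unfolding set_replicate_pmf by (rule finite_subset[OF _ finite_lists_length_eq[of "set_pmf p" m]]) auto

lemma expectation_replicate_pmf_Suc:
  fixes h :: "'a list \<Rightarrow> real"
  assumes "finite (set_pmf p)"
  shows "measure_pmf.expectation (replicate_pmf (Suc m) p) h =
    measure_pmf.expectation p (\<lambda>x. measure_pmf.expectation (replicate_pmf m p) (\<lambda>xs. h (x # xs)))"
  using assms finite_set_replicate_pmf[OF assms, of m]
  by (simp add: expectation_bind_finite)

lemma expectation_replicate_pmf_add:
  fixes h :: "'a list \<Rightarrow> real"
  assumes "finite (set_pmf p)"
  shows "measure_pmf.expectation (replicate_pmf (m + k) p) h =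
    measure_pmf.expectation (replicate_pmf m p)
      (\<lambda>xs. measure_pmf.expectation (replicate_pmf k p) (\<lambda>ys. h (xs @ ys)))"
  unfolding replicate_pmf_distrib
  using assms finite_set_replicate_pmf[OF assms]
  by (simp add: expectation_bind_finite)

text \<open>Conditioning on the first \<open>m\<close> samples: a prefix in \<open>B\<close> is
  charged its full probability, any other prefix at most \<open>d\<close>. This chains the
  phases.\<close>

lemma prob_replicate_pmf_add_le:
  assumes p: "finite (set_pmf p)" and d: "d \<ge> 0"
    and le: "\<And>xs. xs \<in> set_pmf (replicate_pmf m p) \<Longrightarrow> xs \<notin> B \<Longrightarrow>
      measure_pmf.prob (replicate_pmf k p) {ys. xs @ ys \<in> X} \<le> d"
  shows "measure_pmf.prob (replicate_pmf (m + k) p) X \<le> measure_pmf.prob (replicate_pmf m p) B + d"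
proof -
  let ?P = "replicate_pmf m p" and ?Q = "replicate_pmf k p"
  have int: "integrable ?P f" for f :: "'a list \<Rightarrow> real"
    by (rule integrable_measure_pmf_finite) (rule finite_set_replicate_pmf[OF p])
  have "measure_pmf.prob (replicate_pmf (m + k) p) X =
      measure_pmf.expectation (replicate_pmf (m + k) p) (indicator X)"
    by simp
  also have "\<dots> = measure_pmf.expectation ?P (\<lambda>xs. measure_pmf.expectation ?Q (\<lambda>ys. indicator X (xs @ ys)))"
    by (rule expectation_replicate_pmf_add[OF p])
  also have "\<dots> \<le> measure_pmf.expectation ?P (\<lambda>xs. indicator B xs + d)"
  proof (rule integral_mono_AE[OF int int], rule AE_pmfI)
    fix xs assume xs: "xs \<in> set_pmf ?P"
    have "measure_pmf.expectation ?Q (\<lambda>ys. indicator X (xs @ ys)) =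
        measure_pmf.expectation ?Q (indicator {ys. xs @ ys \<in> X})"
      by (intro Bochner_Integration.integral_cong refl) (simp add: indicator_def)
    also have "\<dots> = measure_pmf.prob ?Q {ys. xs @ ys \<in> X}"
      by simp
    also have "\<dots> \<le> indicator B xs + d"
    proof (cases "xs \<in> B")
      case True
      then have "indicator B xs = (1 :: real)" by simp
      then show ?thesis
        using d measure_pmf.prob_le_1[of ?Q "{ys. xs @ ys \<in> X}"] by linarith
    qed (use le[OF xs] in simp)
    finally show "measure_pmf.expectation ?Q (\<lambda>ys. indicator X (xs @ ys)) \<le> indicator B xs + d" .
  qed
  also have "\<dots> = measure_pmf.prob ?P B + d"
    by (subst Bochner_Integration.integral_add[OF int int]) simp
  finally show ?thesis .
qed

lemma markov_pmf:
  assumes p: "finite (set_pmf p)" and t: "t > 0"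
    and f: "\<And>x. 0 \<le> f x" and X: "\<And>x. x \<in> X \<Longrightarrow> t \<le> f x"
  shows "measure_pmf.prob p X \<le> measure_pmf.expectation p f / t"
proof -
  have int: "integrable p f" for f :: "'a \<Rightarrow> real"
    by (rule integrable_measure_pmf_finite[OF p])
  have "measure_pmf.prob p X = measure_pmf.expectation p (indicator X)" by simp
  also have "\<dots> \<le> measure_pmf.expectation p (\<lambda>x. f x / t)"
    using t f X by (intro integral_mono_AE[OF int int] AE_pmfI) (auto simp: indicator_def field_simps)
  finally show ?thesis by simp
qed

section \<open>Iterating the one-round estimate over a phase\<close>

definition grow :: "(nat \<Rightarrow> 'k) \<Rightarrow> ('k \<Rightarrow> 'k \<Rightarrow> bool) \<Rightarrow> edge list \<Rightarrow> edge set \<Rightarrow> edge set" where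
  "grow ty A es E = E \<union> {e \<in> set es. permitted ty A e}"

lemma grow_Nil: "grow ty A [] E = E"
  by (simp add: grow_def)

lemma grow_Cons: "grow ty A (e # es) E = grow ty A es (extend ty A e E)"
  by (auto simp: grow_def extend_def)

lemma deficit_nonneg: "0 \<le> deficit n ty b E \<tau>"
  by (simp add: deficit_def sum_nonneg)

text \<open>The weight lost per round by type \<open>i\<close>: the speed of the straight
  characteristic, independent of the current graph.\<close>

definition shift :: "nat \<Rightarrow> ('k::finite \<Rightarrow> 'k \<Rightarrow> bool) \<Rightarrow> ('k \<Rightarrow> real) \<Rightarrow> 'k \<Rightarrow> real" where
  "shift n A b i = 2 / real n * (\<Sum>a\<in>UNIV. of_bool (A a i) * b a)"

lemma shift_nonneg: "(\<And>i. 0 \<le> b i) \<Longrightarrow> 0 \<le> shift n A b i"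
  unfolding shift_def by (intro mult_nonneg_nonneg sum_nonneg) auto

text \<open>Gronwall by peeling off the first edge. With \<open>m\<close> rounds to go the weights
  are \<open>\<theta>\<close> plus \<open>m\<close> shifts, so one round leads exactly to the
  weights in the induction hypothesis; \<open>E\<close> is arbitrary because the first edge changes
  it.\<close>

lemma deficit_process:
  fixes ty :: "nat \<Rightarrow> 'k::finite" and \<theta> :: "'k \<Rightarrow> real"
  assumes n: "n \<ge> 2" and A: "symp A" and \<eta>: "\<eta> > 0" and \<theta>: "\<And>i. \<eta> \<le> \<theta> i"
    and b: "\<And>i. 0 \<le> b i" "\<And>i. b i \<le> 1"
  defines "K \<equiv> real (CARD('k))"
  shows "measure_pmf.expectation (edge_process n m) (\<lambda>es. deficit n ty b (grow ty A es E) (\<lambda>u. \<theta> (ty u)))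
    \<le> (1 + 4 * K / (\<eta> * n)) ^ m *
      (deficit n ty b E (\<lambda>u. \<theta> (ty u) + real m * shift n A b (ty u)) + real m * drift_const K \<eta> / (real n)\<^sup>2)"
proof (induction m arbitrary: E)
  case 0
  show ?case by (simp add: edge_process_def grow_Nil)
next
  case (Suc m)
  let ?p = "pmf_of_set (all_edges n)" and ?c = "1 + 4 * K / (\<eta> * n)"
  let ?s = "shift n A b" and ?C = "drift_const K \<eta> / (real n)\<^sup>2"
  have fin: "finite (set_pmf ?p)" using n by simp
  have int: "integrable ?p f" for f :: "edge \<Rightarrow> real"
    by (rule integrable_measure_pmf_finite[OF fin])
  have c: "?c \<ge> 1" using n \<eta> by (simp add: K_def)
  have C: "?C \<ge> 0" by (simp add: drift_const_nonneg K_def)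
  have "measure_pmf.expectation (edge_process n (Suc m))
        (\<lambda>es. deficit n ty b (grow ty A es E) (\<lambda>u. \<theta> (ty u)))
      = measure_pmf.expectation ?p (\<lambda>e. measure_pmf.expectation (edge_process n m)
        (\<lambda>es. deficit n ty b (grow ty A es (extend ty A e E)) (\<lambda>u. \<theta> (ty u))))"
    unfolding edge_process_def by (subst expectation_replicate_pmf_Suc[OF fin]) (simp add: grow_Cons)
  also have "\<dots> \<le> measure_pmf.expectation ?p (\<lambda>e. ?c ^ m *
      (deficit n ty b (extend ty A e E) (\<lambda>u. \<theta> (ty u) + real m * ?s (ty u)) + real m * drift_const K \<eta> / (real n)\<^sup>2))"
    by (intro integral_mono int Suc.IH)
  also have "\<dots> = ?c ^ m * (measure_pmf.expectation ?p
      (\<lambda>e. deficit n ty b (extend ty A e E) (\<lambda>u. \<theta> (ty u) + real m * ?s (ty u))) + real m * ?C)"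
    by (simp add: Bochner_Integration.integral_add[OF int int])
  also have "\<dots> \<le> ?c ^ m * ((?c * deficit n ty b E (\<lambda>u. (\<theta> (ty u) + real m * ?s (ty u)) + ?s (ty u)) + ?C) + real m * ?C)"
  proof (intro mult_left_mono add_right_mono)
    show "measure_pmf.expectation ?p
        (\<lambda>e. deficit n ty b (extend ty A e E) (\<lambda>u. \<theta> (ty u) + real m * ?s (ty u)))
      \<le> ?c * deficit n ty b E (\<lambda>u. (\<theta> (ty u) + real m * ?s (ty u)) + ?s (ty u)) + ?C"
    proof -
      have "\<eta> \<le> \<theta> i + real m * ?s i" for i
        using \<theta>[of i] shift_nonneg[of b n A i, OF b(1)] by (simp add: add_increasing2)
      from deficit_step[where \<theta> = "\<lambda>i. \<theta> i + real m * ?s i" and b = b and ty = ty and E = E, OF n A \<eta> this b]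
      show ?thesis unfolding K_def shift_def by simp
    qed
  qed (use c in simp)
  also have "\<dots> \<le> ?c ^ m * (?c * (deficit n ty b E (\<lambda>u. (\<theta> (ty u) + real m * ?s (ty u)) + ?s (ty u)) + real (Suc m) * ?C))"
  proof (intro mult_left_mono)
    have distr: "c * x + y + k * y \<le> c * (x + (1 + k) * y)" if "1 * ((1 + k) * y) \<le> c * ((1 + k) * y)"
      for c x y k :: real
      using that by (simp add: algebra_simps)
    have "1 * (real (Suc m) * ?C) \<le> ?c * (real (Suc m) * ?C)"
      using c C by (intro mult_right_mono mult_nonneg_nonneg) auto
    then show "?c * deficit n ty b E (\<lambda>u. (\<theta> (ty u) + real m * ?s (ty u)) + ?s (ty u)) + ?C + real m * ?C
      \<le> ?c * (deficit n ty b E (\<lambda>u. (\<theta> (ty u) + real m * ?s (ty u)) + ?s (ty u)) + real (Suc m) * ?C)"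
      unfolding of_nat_Suc by (rule distr)
  qed (use c in simp)
  also have "(\<lambda>u. (\<theta> (ty u) + real m * ?s (ty u)) + ?s (ty u)) = (\<lambda>u. \<theta> (ty u) + real (Suc m) * ?s (ty u))"
    by (auto simp: algebra_simps)
  finally show ?case by (simp add: mult_ac)
qed

text \<open>Starting at or above \<open>b\<close> means zero initial deficit. At most
  \<open>n\<close> rounds keep the Gronwall factor below \<open>exp (4 * K / \<eta>)\<close>, so the
  mean deficit is of order \<open>1 / n\<close>, and Markov's inequality finishes.\<close>

lemma mass_process:
  fixes ty :: "nat \<Rightarrow> 'k::finite" and \<theta> :: "'k \<Rightarrow> real"
  assumes n: "n \<ge> 2" and A: "symp A" and \<eta>: "\<eta> > 0" and \<theta>: "\<And>i. \<eta> \<le> \<theta> i"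
    and b: "\<And>i. 0 \<le> b i" "\<And>i. b i \<le> 1" and m: "m \<le> n" and \<sigma>: "\<sigma> > 0"
    and start: "\<And>j. b j \<le> mass n ty E (\<lambda>u. \<theta> (ty u) + real m * shift n A b (ty u)) j"
  defines "K \<equiv> real (CARD('k))"
  shows "measure_pmf.prob (edge_process n m) {es. \<exists>j. mass n ty (grow ty A es E) (\<lambda>u. \<theta> (ty u)) j < b j - \<sigma>}
    \<le> exp (4 * K / \<eta>) * drift_const K \<eta> / \<sigma>\<^sup>2 / n"
proof -
  let ?f = "\<lambda>es. deficit n ty b (grow ty A es E) (\<lambda>u. \<theta> (ty u))"
  have fin: "finite (set_pmf (edge_process n m))"
    unfolding edge_process_def by (rule finite_set_replicate_pmf) (use n in simp)
  have C: "drift_const K \<eta> \<ge> 0" by (simp add: drift_const_nonneg K_def)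
  have "measure_pmf.prob (edge_process n m) {es. \<exists>j. mass n ty (grow ty A es E) (\<lambda>u. \<theta> (ty u)) j < b j - \<sigma>}
      \<le> measure_pmf.expectation (edge_process n m) ?f / \<sigma>\<^sup>2"
  proof (rule markov_pmf[OF fin])
    fix es assume "es \<in> {es. \<exists>j. mass n ty (grow ty A es E) (\<lambda>u. \<theta> (ty u)) j < b j - \<sigma>}"
    then obtain j where j: "mass n ty (grow ty A es E) (\<lambda>u. \<theta> (ty u)) j < b j - \<sigma>" by auto
    have "\<sigma>\<^sup>2 \<le> (max 0 (b j - mass n ty (grow ty A es E) (\<lambda>u. \<theta> (ty u)) j))\<^sup>2"
      using j \<sigma> by (intro power_mono) auto
    also have "\<dots> \<le> ?f es"
      unfolding deficit_def by (rule member_le_sum) auto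
    finally show "\<sigma>\<^sup>2 \<le> ?f es" .
  qed (use \<sigma> in \<open>auto simp: deficit_nonneg\<close>)
  also have "measure_pmf.expectation (edge_process n m) ?f \<le> exp (4 * K / \<eta>) * (drift_const K \<eta> / n)"
  proof -
    have "deficit n ty b E (\<lambda>u. \<theta> (ty u) + real m * shift n A b (ty u)) = 0"
      using start by (simp add: deficit_def)
    then have "measure_pmf.expectation (edge_process n m) ?f
        \<le> (1 + 4 * K / (\<eta> * n)) ^ m * (real m * drift_const K \<eta> / (real n)\<^sup>2)"
      using deficit_process[where m = m and E = E and ty = ty and b = b and \<theta> = \<theta>, OF n A \<eta> \<theta> b] by (simp add: K_def)
    also have "\<dots> \<le> exp (4 * K / \<eta>) * (drift_const K \<eta> / n)"
    proof (intro mult_mono)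
      have "(1 + 4 * K / (\<eta> * n)) ^ m \<le> exp (4 * K / (\<eta> * n)) ^ m"
        using \<eta> by (intro power_mono exp_ge_add_one_self) (auto simp: K_def)
      also have "\<dots> = exp (real m * (4 * K / (\<eta> * n)))" by (rule exp_of_nat_mult[symmetric])
      also have "\<dots> \<le> exp (real n * (4 * K / (\<eta> * n)))"
        using m \<eta> by (intro exp_mono mult_right_mono) (auto simp: K_def)
      also have "\<dots> = exp (4 * K / \<eta>)" using n by simp
      finally show "(1 + 4 * K / (\<eta> * n)) ^ m \<le> exp (4 * K / \<eta>)" .
      have "real m * drift_const K \<eta> / (real n)\<^sup>2 \<le> real n * drift_const K \<eta> / (real n)\<^sup>2"
        using m C by (intro divide_right_mono mult_right_mono) auto
      also have "\<dots> = drift_const K \<eta> / n" using n by (simp add: power2_eq_square)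
      finally show "real m * drift_const K \<eta> / (real n)\<^sup>2 \<le> drift_const K \<eta> / n" .
    qed (use C in auto)
    finally show ?thesis .
  qed
  finally show ?thesis using \<sigma> by (simp add: divide_right_mono mult_ac)
qed

subsection \<open>Sprinkling\<close>

lemma all_edgesD: "e \<in> all_edges n \<Longrightarrow> e \<subseteq> {..<n} \<and> finite e \<and> card e = 2"
  unfolding all_edges_def nsets_def by simp

lemma edge_processD:
  assumes "es \<in> set_pmf (edge_process n m)" "n \<ge> 2"
  shows "length es = m" "set es \<subseteq> all_edges n"
  using assms unfolding edge_process_def set_replicate_pmf by auto

lemma prob_replicate_pmf_all:
  assumes p: "finite (set_pmf p)"
  shows "measure_pmf.prob (replicate_pmf m p) {xs. \<forall>x\<in>set xs. Q x} = measure_pmf.prob p {x. Q x} ^ m"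
proof -
  have "measure_pmf.expectation (replicate_pmf m p) (indicator {xs. \<forall>x\<in>set xs. Q x})
      = measure_pmf.prob p {x. Q x} ^ m"
  proof (induction m)
    case 0
    show ?case by simp
  next
    case (Suc m)
    have "measure_pmf.expectation (replicate_pmf (Suc m) p) (indicator {xs. \<forall>x\<in>set xs. Q x}) =
        measure_pmf.expectation p (\<lambda>x. measure_pmf.expectation (replicate_pmf m p)
          (\<lambda>xs. indicator {x. Q x} x * (indicator {xs. \<forall>x\<in>set xs. Q x} xs :: real)))"
      by (subst expectation_replicate_pmf_Suc[OF p])
        (intro Bochner_Integration.integral_cong refl, simp add: indicator_def)
    also have "\<dots> = measure_pmf.prob p {x. Q x} ^ Suc m"
      using Suc by simp
    finally show ?case .
  qed
  then show ?thesis by simp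
qed

text \<open>Counting one order of the endpoints already gives crossing probability at least
  \<open>card Y * card Z / n\<^sup>2\<close> per round; independence and
  \<open>1 - q \<le> exp (- q)\<close> do the rest.\<close>

lemma prob_no_crossing_le:
  assumes n: "n \<ge> 2" and YZ: "Y \<subseteq> {..<n}" "Z \<subseteq> {..<n}" "Y \<inter> Z = {}"
  shows "measure_pmf.prob (edge_process n m) {es. \<forall>e\<in>set es. e \<inter> Y = {} \<or> e \<inter> Z = {}}
    \<le> exp (- (real m * (real (card Y) * real (card Z) / (real n)\<^sup>2)))"
proof -
  let ?p = "pmf_of_set (all_edges n)" and ?q = "real (card Y) * real (card Z) / (real n)\<^sup>2"
  let ?C = "{e. \<not> (e \<inter> Y = {} \<or> e \<inter> Z = {})}"
  have fin: "finite (set_pmf ?p)" using n by simp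
  have finYZ: "finite Y" "finite Z"
    by (rule finite_subset[OF YZ(1)], simp, rule finite_subset[OF YZ(2)], simp)
  have "real (card Y) * real (card Z) = (\<Sum>u\<in>Y. \<Sum>v\<in>Z. indicator ?C {u, v})"
    by simp
  also have "\<dots> \<le> (\<Sum>u\<in>Y. \<Sum>v\<in>{..<n} - {u}. indicator ?C {u, v})"
    using YZ by (intro sum_mono sum_mono2) auto
  also have "\<dots> \<le> (\<Sum>u<n. \<Sum>v\<in>{..<n} - {u}. indicator ?C {u, v})"
    using YZ by (intro sum_mono2) (auto intro!: sum_nonneg)
  finally have S: "real (card Y) * real (card Z) \<le> \<dots>" .
  have "?q \<le> real (card Y) * real (card Z) / (real n * (real n - 1))"
    using n by (intro divide_left_mono) (auto simp: power2_eq_square)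
  also have "\<dots> \<le> (\<Sum>u<n. \<Sum>v\<in>{..<n} - {u}. indicator ?C {u, v}) / (real n * (real n - 1))"
    using n S by (intro divide_right_mono) auto
  also have "\<dots> = measure_pmf.expectation ?p (indicator ?C)"
    by (rule expectation_edge[OF n, symmetric])
  also have "\<dots> = measure_pmf.prob ?p ?C" by simp
  also have "\<dots> = 1 - measure_pmf.prob ?p {e. e \<inter> Y = {} \<or> e \<inter> Z = {}}"
    by (subst measure_pmf.prob_compl[symmetric]) (auto intro!: arg_cong[where f = "measure_pmf.prob ?p"])
  finally have "measure_pmf.prob ?p {e. e \<inter> Y = {} \<or> e \<inter> Z = {}} \<le> 1 - ?q" by simp
  also have "\<dots> \<le> exp (- ?q)"
    using exp_ge_add_one_self[of "- ?q"] by simp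
  finally have "measure_pmf.prob ?p {e. e \<inter> Y = {} \<or> e \<inter> Z = {}} ^ m \<le> exp (- ?q) ^ m"
    by (intro power_mono) auto
  then show ?thesis
    unfolding edge_process_def prob_replicate_pmf_all[OF fin]
    by (simp add: exp_of_nat_mult[symmetric])
qed

text \<open>Adding items one by one, the total first reaches \<open>s\<close> by a step smaller than
  \<open>s\<close>, hence is then still below \<open>2 * s\<close>.\<close>

lemma greedy_subfamily:
  fixes f :: "'a \<Rightarrow> real"
  assumes "s > 0" "finite P" "\<And>x. x \<in> P \<Longrightarrow> f x < s" "s \<le> sum f P"
  shows "\<exists>Q\<subseteq>P. s \<le> sum f Q \<and> sum f Q < 2 * s"
  using assms(2-)
proof (induction P rule: finite_induct)
  case empty
  with assms(1) show ?case by simp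
next
  case (insert x F)
  show ?case
  proof (cases "s \<le> sum f F")
    case True
    then show ?thesis using insert by blast
  next
    case False
    then have "sum f (insert x F) < 2 * s" using insert.hyps insert.prems(1)[of x] by simp
    then show ?thesis using insert.prems(2) by blast
  qed
qed

text \<open>The components cut \<open>X\<close> into pieces smaller than \<open>s\<close>. Greedily
  chosen pieces form \<open>Y\<close> with fewer than \<open>2 * s\<close> vertices, which leaves at
  least \<open>s\<close> outside.\<close>

lemma balanced_separation:
  assumes X: "X \<subseteq> {..<n}" and s: "s > 0" and big: "3 * s \<le> real (card X)"
    and small: "\<And>v. v < n \<Longrightarrow> real (card (comp n E v)) < s"
  shows "\<exists>Y\<subseteq>X. s \<le> real (card Y) \<and> s \<le> real (card (X - Y)) \<and>
    (\<forall>v\<in>Y. comp n E v \<inter> X \<subseteq> Y) \<and> (\<forall>e\<in>E. card e = 2 \<longrightarrow> e \<inter> Y = {} \<or> e \<inter> (X - Y) = {})"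
proof -
  define P where "P = (\<lambda>v. comp n E v \<inter> X) ` X"
  have finX: "finite X" by (rule finite_subset[OF X]) simp
  have mem: "v \<in> comp n E v \<inter> X" if "v \<in> X" for v
    using that X comp_self by auto
  have disj: "C = D" if CD: "C \<in> P" "D \<in> P" "C \<inter> D \<noteq> {}" for C D
  proof -
    obtain a c d where "C = comp n E c \<inter> X" "D = comp n E d \<inter> X" "a \<in> comp n E c" "a \<in> comp n E d"
      using CD unfolding P_def by auto
    then show ?thesis using comp_eqI by metis
  qed
  have finP: "finite P" using finX by (simp add: P_def)
  have fin_mem: "finite C" if "C \<in> P" for C
    using that by (auto simp: P_def)
  have UP: "\<Union>P = X" using mem by (auto simp: P_def)
  have card_U: "card (\<Union>Q) = sum card Q" if QP: "Q \<subseteq> P" for Q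
  proof (rule card_Union_disjoint)
    show "pairwise disjnt Q"
    proof (rule pairwiseI)
      fix C D
      assume "C \<in> Q" "D \<in> Q" "C \<noteq> D"
      then show "disjnt C D" using QP disj[of C D] by (auto simp: disjnt_def)
    qed
    show "finite C" if "C \<in> Q" for C using that QP fin_mem by auto
  qed
  have "\<exists>Q\<subseteq>P. s \<le> (\<Sum>C\<in>Q. real (card C)) \<and> (\<Sum>C\<in>Q. real (card C)) < 2 * s"
  proof (rule greedy_subfamily[OF s finP])
    fix C assume "C \<in> P"
    then obtain v where v: "C = comp n E v \<inter> X" "v \<in> X" by (auto simp: P_def)
    then have "card C \<le> card (comp n E v)" by (intro card_mono) auto
    with small[of v] v X show "real (card C) < s" by fastforce
  next
    have "(\<Sum>C\<in>P. real (card C)) = real (card X)"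
      using card_U[of P] UP by simp
    then show "s \<le> (\<Sum>C\<in>P. real (card C))" using big s by linarith
  qed
  then obtain Q where Q: "Q \<subseteq> P" "s \<le> (\<Sum>C\<in>Q. real (card C))" "(\<Sum>C\<in>Q. real (card C)) < 2 * s"
    using s by auto
  define Y where "Y = \<Union>Q"
  have YX: "Y \<subseteq> X" using Q(1) UP by (auto simp: Y_def)
  have cY: "real (card Y) = (\<Sum>C\<in>Q. real (card C))"
    using card_U[OF Q(1)] by (simp add: Y_def)
  have "card (X - Y) = card X - card Y" "card Y \<le> card X"
    using YX finX by (simp_all add: card_Diff_subset finite_subset card_mono)
  then have "s \<le> real (card (X - Y))" using Q(3) big cY by (simp add: of_nat_diff)
  moreover have closed: "comp n E v \<inter> X \<subseteq> Y" if vY: "v \<in> Y" for v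
  proof -
    obtain C where C: "C \<in> Q" "v \<in> C" using vY by (auto simp: Y_def)
    then obtain w where "C = comp n E w \<inter> X" using Q(1) by (auto simp: P_def)
    then have "comp n E v = comp n E w" using C comp_eqI by blast
    then show ?thesis using C \<open>C = _\<close> by (auto simp: Y_def)
  qed
  moreover have "e \<inter> Y = {} \<or> e \<inter> (X - Y) = {}" if "e \<in> E" "card e = 2" for e
  proof (rule ccontr)
    assume "\<not> ?thesis"
    then obtain u v where uv: "u \<in> e" "u \<in> Y" "v \<in> e" "v \<in> X" "v \<notin> Y" by auto
    then have "e = {u, v}" using that(2) by (auto simp: card_2_iff)
    then have "v \<in> comp n E u" using that(1) uv X joined_edge by (auto simp: mem_comp)
    then show False using closed[OF uv(2)] uv by auto
  qed
  moreover have "s \<le> real (card Y)" using Q(2) cY by simp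
  ultimately show ?thesis using YX by (intro exI[of _ Y]) blast
qed

text \<open>A failure splits \<open>X\<close> into two parts of at least \<open>c / 3 * n\<close>
  vertices, each a union of old components, with no new edge across. Old components in
  \<open>X\<close> have at least \<open>M\<close> vertices, so there are at most \<open>2\<close> to
  the power \<open>n / M\<close> splits, and a union bound over them suffices.\<close>

lemma sprinkling:
  fixes E :: "edge set" and n M m :: nat and c :: real
  assumes n: "n \<ge> 2" and c: "c > 0" and M: "M > 0"
  defines "X \<equiv> {v. v < n \<and> M \<le> card (comp n E v)}"
  assumes X: "c * real n \<le> real (card X)"
  shows "measure_pmf.prob (edge_process n m)
      {es. \<forall>v<n. real (card (comp n (E \<union> set es) v)) < c / 3 * real n}
    \<le> exp (ln 2 * (real n / real M) - real m * (c\<^sup>2 / 9))"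
proof -
  let ?p = "pmf_of_set (all_edges n)"
  let ?s = "c / 3 * real n"
  define B where "B = comp n E ` X"
  define F where "F = {S. S \<subseteq> B \<and> \<Union>S \<subseteq> X \<and> ?s \<le> real (card (\<Union>S)) \<and> ?s \<le> real (card (X - \<Union>S))}"
  define N where "N S = {es. \<forall>e\<in>set es. e \<inter> \<Union>S = {} \<or> e \<inter> (X - \<Union>S) = {}}" for S :: "nat set set"
  have XV: "X \<subseteq> {..<n}" by (auto simp: X_def)
  then have finX: "finite X" by (rule finite_subset) simp
  have s: "?s > 0" using c n by simp
  have finB: "finite B" using finX by (simp add: B_def)
  have finF: "finite F" by (rule finite_subset[of _ "Pow B"]) (use finB in \<open>auto simp: F_def\<close>)
  have "real M * real (card B) \<le> real n"
  proof -
    have "disjnt C D" if CD: "C \<in> B" "D \<in> B" "C \<noteq> D" for C D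
    proof (rule ccontr)
      assume "\<not> disjnt C D"
      then obtain a where a: "a \<in> C" "a \<in> D" by (auto simp: disjnt_def)
      obtain x y where "C = comp n E x" "D = comp n E y" using CD by (auto simp: B_def)
      then show False using a CD(3) comp_eqI by metis
    qed
    then have "card (\<Union>B) = sum card B"
      by (intro card_Union_disjoint) (auto simp: pairwise_def B_def)
    moreover have "(\<Sum>C\<in>B. M) \<le> sum card B"
    proof (rule sum_mono)
      fix C assume "C \<in> B"
      then obtain v where "v \<in> X" "C = comp n E v" unfolding B_def by (rule imageE)
      then show "M \<le> card C" by (simp add: X_def)
    qed
    moreover have "card (\<Union>B) \<le> n"
    proof -
      have "\<Union>B \<subseteq> {..<n}"
      proof
        fix w assume "w \<in> \<Union>B"
        then obtain v where "w \<in> comp n E v" by (auto simp: B_def)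
        then show "w \<in> {..<n}" by (simp add: mem_comp)
      qed
      then show ?thesis using card_mono[of "{..<n}" "\<Union>B"] by simp
    qed
    ultimately have "M * card B \<le> n" by (simp add: mult.commute)
    then show ?thesis by (metis of_nat_le_iff of_nat_mult)
  qed
  then have cB: "real (card B) \<le> real n / real M" using M by (simp add: field_simps)
  have cF: "real (card F) \<le> exp (ln 2 * (real n / real M))"
  proof -
    have "card F \<le> card (Pow B)" by (intro card_mono) (use finB in \<open>auto simp: F_def\<close>)
    then have "real (card F) \<le> 2 ^ card B" using finB by (simp add: card_Pow)
    also have "\<dots> = exp (ln 2 * real (card B))"
      by (simp add: powr_realpow[symmetric] powr_def mult.commute)
    also have "\<dots> \<le> exp (ln 2 * (real n / real M))"
      using cB by (intro exp_mono mult_left_mono) auto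
    finally show ?thesis .
  qed
  have "measure_pmf.prob (edge_process n m)
      {es. \<forall>v<n. real (card (comp n (E \<union> set es) v)) < ?s} \<le>
    measure_pmf.prob (edge_process n m) (\<Union>S\<in>F. N S)"
  proof (rule measure_pmf.finite_measure_mono_AE, rule AE_pmfI, rule impI)
    fix es assume es: "es \<in> set_pmf (edge_process n m)"
      and "es \<in> {es. \<forall>v<n. real (card (comp n (E \<union> set es) v)) < ?s}"
    then have small: "\<And>v. v < n \<Longrightarrow> real (card (comp n (E \<union> set es) v)) < ?s" by auto
    have two: "card e = 2" if "e \<in> set es" for e
      using edge_processD(2)[OF es n] that all_edgesD by blast
    obtain Y where Y: "Y \<subseteq> X" "?s \<le> real (card Y)" "?s \<le> real (card (X - Y))"
      "\<forall>v\<in>Y. comp n (E \<union> set es) v \<inter> X \<subseteq> Y"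
      "\<forall>e\<in>E \<union> set es. card e = 2 \<longrightarrow> e \<inter> Y = {} \<or> e \<inter> (X - Y) = {}"
      using balanced_separation[of X n ?s "E \<union> set es", OF XV s _ small] X by auto
    \<comment> \<open>All vertices of an old component see the same size, so a component meeting
      \<open>X\<close> lies in \<open>X\<close>. Hence \<open>Y\<close> is a union of whole old
      components, one of the counted splits.\<close>
    have "comp n E v \<subseteq> Y" if "v \<in> Y" for v
    proof
      fix w assume w: "w \<in> comp n E v"
      then have "card (comp n E w) = card (comp n E v)" by (simp add: comp_eqI)
      moreover have "v \<in> X" using that Y(1) by auto
      ultimately have "w \<in> X" using w by (auto simp: X_def mem_comp)
      moreover have "w \<in> comp n (E \<union> set es) v" using w comp_mono[of E "E \<union> set es" n v] by auto
      ultimately show "w \<in> Y" using Y(4) that by auto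
    qed
    moreover have "v \<in> comp n E v" if "v \<in> Y" for v
      using that Y(1) XV comp_self by auto
    ultimately have UY: "\<Union>(comp n E ` Y) = Y" by auto
    then have "comp n E ` Y \<in> F"
      using Y unfolding F_def B_def mem_Collect_eq UY by auto
    moreover have "es \<in> N (comp n E ` Y)"
      unfolding N_def mem_Collect_eq UY using Y(5) two by auto
    ultimately show "es \<in> (\<Union>S\<in>F. N S)" by auto
  qed auto
  also have "\<dots> \<le> (\<Sum>S\<in>F. measure_pmf.prob (edge_process n m) (N S))"
    by (rule measure_pmf.finite_measure_subadditive_finite[OF finF]) auto
  also have "\<dots> \<le> (\<Sum>S\<in>F. exp (- (real m * (c\<^sup>2 / 9))))"
  proof (rule sum_mono)
    fix S assume "S \<in> F"
    then have S: "\<Union>S \<subseteq> X" "?s \<le> real (card (\<Union>S))" "?s \<le> real (card (X - \<Union>S))"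
      by (auto simp: F_def)
    have "measure_pmf.prob (edge_process n m) (N S) \<le>
        exp (- (real m * (real (card (\<Union>S)) * real (card (X - \<Union>S)) / (real n)\<^sup>2)))"
      unfolding N_def by (rule prob_no_crossing_le[OF n]) (use S(1) XV in auto)
    also have "\<dots> \<le> exp (- (real m * (c\<^sup>2 / 9)))"
    proof -
      have le: "?s * ?s / (real n)\<^sup>2 \<le> real (card (\<Union>S)) * real (card (X - \<Union>S)) / (real n)\<^sup>2"
        using S s by (intro divide_right_mono mult_mono) auto
      have eq: "?s * ?s / (real n)\<^sup>2 = c\<^sup>2 / 9" using n by (simp add: power2_eq_square)
      have "real m * (c\<^sup>2 / 9) \<le> real m * (real (card (\<Union>S)) * real (card (X - \<Union>S)) / (real n)\<^sup>2)"
        by (rule mult_left_mono[OF le[unfolded eq]]) simp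
      then show ?thesis by simp
    qed
    finally show "measure_pmf.prob (edge_process n m) (N S) \<le> exp (- (real m * (c\<^sup>2 / 9)))" .
  qed
  also have "\<dots> = real (card F) * exp (- (real m * (c\<^sup>2 / 9)))" by simp
  also have "\<dots> \<le> exp (ln 2 * (real n / real M)) * exp (- (real m * (c\<^sup>2 / 9)))"
    using cF by (intro mult_right_mono) auto
  also have "\<dots> = exp (ln 2 * (real n / real M) - real m * (c\<^sup>2 / 9))"
    by (simp add: exp_add[symmetric])
  finally show ?thesis .
qed

subsection \<open>The strategy\<close>

text \<open>The product of \<open>1 - x + x\<^sup>2 / 2\<close> and
  \<open>1 + x + x\<^sup>2 / 2\<close> is \<open>1 + x ^ 4 / 4\<close>, and the second factor is at
  most \<open>exp x\<close>.\<close>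

lemma one_minus_exp_ge:
  fixes x :: real
  assumes "0 \<le> x"
  shows "x - x\<^sup>2 / 2 \<le> 1 - exp (- x)"
proof -
  have pos: "0 < 1 + x + x\<^sup>2 / 2" using assms by (simp add: add_pos_nonneg)
  have "(1 - x + x\<^sup>2 / 2) * (1 + x + x\<^sup>2 / 2) = 1 + x ^ 4 / 4"
    by (simp add: field_simps power2_eq_square power4_eq_xxxx)
  then have "1 \<le> (1 - x + x\<^sup>2 / 2) * (1 + x + x\<^sup>2 / 2)" by simp
  then have "1 / (1 + x + x\<^sup>2 / 2) \<le> 1 - x + x\<^sup>2 / 2"
    using pos by (simp add: divide_le_eq)
  moreover have "exp (- x) \<le> 1 / (1 + x + x\<^sup>2 / 2)"
    using exp_lower_Taylor_quadratic[OF assms] pos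
    by (simp add: exp_minus inverse_eq_divide divide_left_mono)
  ultimately show ?thesis by simp
qed

lemma mass_const_type:
  assumes "\<And>v. v < n \<Longrightarrow> ty v = j \<Longrightarrow> comp n E v = {v}"
  shows "mass n ty E (\<lambda>u. \<theta> (ty u)) j = real (card {v. v < n \<and> ty v = j}) / real n * (1 - exp (- \<theta> j))"
proof -
  have "(\<Sum>v | v < n \<and> ty v = j. reach n E (\<lambda>u. \<theta> (ty u)) v) = (\<Sum>v | v < n \<and> ty v = j. 1 - exp (- \<theta> j))"
    by (intro sum.cong refl) (simp add: reach_def wt_def assms)
  then show ?thesis by (simp add: mass_def)
qed

text \<open>At constant weight \<open>\<eta>\<close>, a vertex in a component with fewer than
  \<open>M\<close> vertices has reach at most \<open>\<eta> * M\<close>; mass beyond that comes from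
  large components.\<close>

lemma card_large_components_ge:
  fixes \<eta> c :: real
  assumes \<eta>: "\<eta> > 0" and n: "n > 0" and le: "c + \<eta> * real M \<le> mass n ty E (\<lambda>_. \<eta>) j"
  shows "c * real n \<le> real (card {v. v < n \<and> M \<le> card (comp n E v)})"
proof -
  let ?X = "{v. v < n \<and> M \<le> card (comp n E v)}" and ?J = "{v. v < n \<and> ty v = j}"
  have bound: "reach n E (\<lambda>_. \<eta>) v \<le> indicator ?X v + \<eta> * real M" if "v < n" for v
  proof (cases "M \<le> card (comp n E v)")
    case True
    then show ?thesis
      using that reach_bounds(2)[of n "\<lambda>_. \<eta>" E v] \<eta> by (simp add: add_increasing2)
  next
    case False
    have "reach n E (\<lambda>_. \<eta>) v \<le> real (card (comp n E v)) * \<eta>"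
      using exp_ge_add_one_self[of "- (real (card (comp n E v)) * \<eta>)"] by (simp add: reach_def wt_def)
    also have "\<dots> \<le> \<eta> * real M"
      using False \<eta> by (simp add: mult.commute)
    finally show ?thesis by (simp add: indicator_def)
  qed
  have "(c + \<eta> * real M) * real n \<le> mass n ty E (\<lambda>_. \<eta>) j * real n"
    using le by (intro mult_right_mono) auto
  also have "\<dots> = (\<Sum>v\<in>?J. reach n E (\<lambda>_. \<eta>) v)"
    using n by (simp add: mass_def)
  also have "\<dots> \<le> (\<Sum>v<n. reach n E (\<lambda>_. \<eta>) v)"
    by (intro sum_mono2) (use reach_bounds(1) \<eta> in auto)
  also have "\<dots> \<le> (\<Sum>v<n. indicator ?X v + \<eta> * real M)"
    by (intro sum_mono bound) simp
  also have "\<dots> = (\<Sum>v<n. indicator ?X v) + real n * (\<eta> * real M)"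
    by (simp add: sum.distrib)
  also have "(\<Sum>v<n. indicator ?X v :: real) = real (card ({..<n} \<inter> ?X))"
    unfolding indicator_def of_bool_def by (subst sum.If_cases) (simp_all add: Int_def)
  also have "{..<n} \<inter> ?X = ?X" by auto
  finally show ?thesis by (simp add: algebra_simps)
qed

lemma untouched_set_exists:
  assumes "set es \<subseteq> all_edges n" "2 * length es + k \<le> n"
  shows "\<exists>T\<subseteq>{..<n}. T \<inter> \<Union>(set es) = {} \<and> card T = k"
proof -
  have "card (\<Union>(set es)) \<le> (\<Sum>e\<in>set es. card e)"
    by (rule card_Union_le_sum_card)
  also have "\<dots> = (\<Sum>e\<in>set es. 2)"
    using assms(1) all_edgesD by (intro sum.cong refl) blast
  also have "\<dots> \<le> 2 * length es"
    using card_length[of es] by simp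
  finally have "card (\<Union>(set es)) \<le> 2 * length es" .
  moreover have "card {..<n} - card (\<Union>(set es)) \<le> card ({..<n} - \<Union>(set es))"
    by (rule diff_card_le_card_Diff) (use assms(1) all_edgesD in auto)
  ultimately have "k \<le> card ({..<n} - \<Union>(set es))" using assms(2) by simp
  then obtain T where "T \<subseteq> {..<n} - \<Union>(set es)" "card T = k"
    by (metis obtain_subset_with_card_n)
  then show ?thesis by blast
qed

lemma in_colour_class: "e \<in> colour_class A (xs @ e # ys) (A xs e)"
proof -
  have "(xs @ e # ys) ! length xs = e" "length xs < length (xs @ e # ys)"
    "colour_of_round A (xs @ e # ys) (length xs) = A xs e"
    by (simp_all add: colour_of_round_def)
  then show ?thesis unfolding colour_class_def by fastforce
qed

text \<open>Write \<open>x = 2 * 0.175\<close>, \<open>y = 2 * 0.5575\<close> and \<open>\<beta> = 0.641\<close>. After the first phase the average red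
  component has size \<open>1 / (1 - x)\<close>, so red is supercritical because \<open>y * (1 / (1 - x) - \<beta>) > 1\<close>. Blue starts
  from scratch in the second phase and is supercritical because \<open>y * \<beta> + y\<^sup>2 * \<beta> * (1 - \<beta>) > 1\<close>. Both left-hand
  sides are below 1.001, which is why the numbers below are so small. The four phases together take
  \<open>0.175 + 0.5575 + 2 * 0.00025 = 0.733\<close> times \<open>n\<close> rounds.\<close>

definition rounds1 :: "nat \<Rightarrow> nat" where "rounds1 n = nat \<lfloor>0.175 * real n\<rfloor>"
definition rounds2 :: "nat \<Rightarrow> nat" where "rounds2 n = nat \<lfloor>0.5575 * real n\<rfloor>"
definition rounds3 :: "nat \<Rightarrow> nat" where "rounds3 n = nat \<lfloor>0.00025 * real n\<rfloor>"
definition spare_size :: "nat \<Rightarrow> nat" where "spare_size n = nat \<lfloor>0.641 * real n\<rfloor>"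

definition spare :: "nat \<Rightarrow> edge list \<Rightarrow> nat set" where
  "spare n es = (SOME T. T \<subseteq> {..<n} \<and> T \<inter> \<Union>(set es) = {} \<and> card T = spare_size n)"

text \<open>The spare set is recomputed from the first \<open>rounds1 n\<close> edges of the
  history, so it is the same set throughout the second phase. The last case takes all remaining
  rounds.\<close>

definition strategy :: "nat \<Rightarrow> online_algorithm" where
  "strategy n es e =
    (if length es < rounds1 n then Red
     else if length es < rounds1 n + rounds2 n then
       (if e \<inter> spare n (take (rounds1 n) es) = {} then Red else Blue)
     else if length es < rounds1 n + rounds2 n + rounds3 n then Red else Blue)"

lemma nat_floor_bounds:
  assumes "0 \<le> x"
  shows "real (nat \<lfloor>x\<rfloor>) \<le> x" "x - 1 \<le> real (nat \<lfloor>x\<rfloor>)"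
  using assms by linarith+

lemma spare_props:
  assumes "set es \<subseteq> all_edges n" "length es = rounds1 n"
  shows "spare n es \<subseteq> {..<n}" "spare n es \<inter> \<Union>(set es) = {}" "card (spare n es) = spare_size n"
proof -
  have "real (rounds1 n) \<le> 0.175 * real n" "real (spare_size n) \<le> 0.641 * real n"
    unfolding rounds1_def spare_size_def by (rule nat_floor_bounds, simp)+
  then have "2 * real (rounds1 n) + real (spare_size n) \<le> real n" by simp
  then have "real (2 * rounds1 n + spare_size n) \<le> real n" by simp
  then have "2 * length es + spare_size n \<le> n" unfolding of_nat_le_iff assms(2) .
  from untouched_set_exists[OF assms(1) this]
  have "\<exists>T. T \<subseteq> {..<n} \<and> T \<inter> \<Union>(set es) = {} \<and> card T = spare_size n" by blast
  from someI_ex[OF this]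
  show "spare n es \<subseteq> {..<n}" "spare n es \<inter> \<Union>(set es) = {}" "card (spare n es) = spare_size n"
    unfolding spare_def by blast+
qed

text \<open>Inclusions suffice, because adding edges keeps a giant component; a repeated edge may
  lie in both classes.\<close>

lemma strategy_classes:
  fixes n and es1 es2 es3 es4 :: "edge list"
  assumes len: "length es1 = rounds1 n" "length es2 = rounds2 n" "length es3 = rounds3 n"
  defines "T \<equiv> spare n es1" and "es \<equiv> es1 @ es2 @ es3 @ es4"
  shows "set es1 \<union> {e \<in> set es2. e \<inter> T = {}} \<union> set es3 \<subseteq> colour_class (strategy n) es Red"
    and "{e \<in> set es2. e \<inter> T \<noteq> {}} \<union> set es4 \<subseteq> colour_class (strategy n) es Blue"
proof -
  have 1: "e \<in> colour_class (strategy n) es Red" if e: "e \<in> set es1" for e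
  proof -
    obtain us vs where es1: "es1 = us @ e # vs" using split_list[OF e] by blast
    have "e \<in> colour_class (strategy n) (us @ e # (vs @ es2 @ es3 @ es4)) (strategy n us e)"
      by (rule in_colour_class)
    moreover have "strategy n us e = Red" using len es1 by (simp add: strategy_def)
    ultimately show ?thesis by (simp add: es_def es1)
  qed
  have 2: "e \<in> colour_class (strategy n) es (if e \<inter> T = {} then Red else Blue)" if e: "e \<in> set es2" for e
  proof -
    obtain us vs where es2: "es2 = us @ e # vs" using split_list[OF e] by blast
    have "e \<in> colour_class (strategy n) ((es1 @ us) @ e # (vs @ es3 @ es4)) (strategy n (es1 @ us) e)"
      by (rule in_colour_class)
    moreover have "strategy n (es1 @ us) e = (if e \<inter> T = {} then Red else Blue)"
      using len es2 by (simp add: strategy_def T_def)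
    ultimately show ?thesis by (simp add: es_def es2)
  qed
  have 3: "e \<in> colour_class (strategy n) es Red" if e: "e \<in> set es3" for e
  proof -
    obtain us vs where es3: "es3 = us @ e # vs" using split_list[OF e] by blast
    have "e \<in> colour_class (strategy n) ((es1 @ es2 @ us) @ e # (vs @ es4)) (strategy n (es1 @ es2 @ us) e)"
      by (rule in_colour_class)
    moreover have "strategy n (es1 @ es2 @ us) e = Red"
      using len es3 by (simp add: strategy_def)
    ultimately show ?thesis by (simp add: es_def es3)
  qed
  have 4: "e \<in> colour_class (strategy n) es Blue" if e: "e \<in> set es4" for e
  proof -
    obtain us vs where es4: "es4 = us @ e # vs" using split_list[OF e] by blast
    have "e \<in> colour_class (strategy n) ((es1 @ es2 @ es3 @ us) @ e # vs) (strategy n (es1 @ es2 @ es3 @ us) e)"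
      by (rule in_colour_class)
    moreover have "strategy n (es1 @ es2 @ es3 @ us) e = Blue"
      using len by (simp add: strategy_def)
    ultimately show ?thesis by (simp add: es_def es4)
  qed
  show "set es1 \<union> {e \<in> set es2. e \<inter> T = {}} \<union> set es3 \<subseteq> colour_class (strategy n) es Red"
  proof
    fix e assume "e \<in> set es1 \<union> {e \<in> set es2. e \<inter> T = {}} \<union> set es3"
    then show "e \<in> colour_class (strategy n) es Red" using 1[of e] 2[of e] 3[of e] by auto
  qed
  show "{e \<in> set es2. e \<inter> T \<noteq> {}} \<union> set es4 \<subseteq> colour_class (strategy n) es Blue"
  proof
    fix e assume "e \<in> {e \<in> set es2. e \<inter> T \<noteq> {}} \<union> set es4"
    then show "e \<in> colour_class (strategy n) es Blue" using 2[of e] 4[of e] by (cases "e \<inter> T = {}") auto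
  qed
qed

text \<open>Types are truth values, \<open>True\<close> meaning outside \<open>T\<close>: red joins
  two vertices of type \<open>True\<close>, blue all other pairs.\<close>

lemma permitted_iff_disjoint:
  assumes "card e = 2"
  shows "permitted (\<lambda>v. v \<notin> T) (\<and>) e \<longleftrightarrow> e \<inter> T = {}"
    and "permitted (\<lambda>v. v \<notin> T) (\<lambda>i j. \<not> (i \<and> j)) e \<longleftrightarrow> e \<inter> T \<noteq> {}"
proof -
  obtain u v where "e = {u, v}" "u \<noteq> v" using assms by (auto simp: card_2_iff)
  then show "permitted (\<lambda>v. v \<notin> T) (\<and>) e \<longleftrightarrow> e \<inter> T = {}"
    "permitted (\<lambda>v. v \<notin> T) (\<lambda>i j. \<not> (i \<and> j)) e \<longleftrightarrow> e \<inter> T \<noteq> {}"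
    by (auto simp: permitted_def)
qed

subsection \<open>Both colours are supercritical\<close>

text \<open>The weight left after the second phase. Sprinkling uses components of size
  \<open>10 ^ 15\<close>, and \<open>eta * 10 ^ 15 = 1 / 10 ^ 5\<close> is well below the surviving
  mass \<open>4 / 10 ^ 5\<close>.\<close>

definition eta :: real where "eta = 1 / 10 ^ 20"


text \<open>One type suffices, as every edge is red. The final ratio of mass to weight is about
  \<open>1 / (1 - 0.35)\<close>, the mean component size.\<close>

lemma phase_one_red:
  assumes n: "n \<ge> 10 ^ 6"
  shows "measure_pmf.prob (edge_process n (rounds1 n))
      {es. mass n (\<lambda>_. ()) (set es) (\<lambda>_. 650029 / 10 ^ 10) () < 99994 / 10 ^ 9}
    \<le> exp (4 / (650029 / 10 ^ 10)) * drift_const 1 (650029 / 10 ^ 10) / (1 / 10 ^ 9)\<^sup>2 / n"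
proof -
  \<comment> \<open>\<open>?b\<close> is \<open>x - x\<^sup>2 / 2\<close> at
    \<open>x = 1 / 10 ^ 4\<close>, a lower bound for the mass of isolated vertices of weight
    \<open>x\<close>. \<open>?h\<close>, rounded up, is what is left of \<open>x\<close> after
    losing \<open>0.34999 * ?b\<close>.\<close>
  let ?h = "650029 / 10 ^ 10 :: real" and ?b = "99995 / 10 ^ 9 :: real"
  let ?A = "\<lambda>_ _ :: unit. True"
  have "real n \<ge> 10 ^ 6" using n by simp
  have r: "real (rounds1 n) \<le> 0.175 * real n" "0.175 * real n - 1 \<le> real (rounds1 n)"
    unfolding rounds1_def by (rule nat_floor_bounds, simp)+
  have start: "?b \<le> mass n (\<lambda>_. ()) {} (\<lambda>_. ?h + real (rounds1 n) * shift n ?A (\<lambda>_. ?b) ()) ()"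
  proof -
    let ?x = "?h + real (rounds1 n) * shift n ?A (\<lambda>_. ?b) ()"
    have "shift n ?A (\<lambda>_. ?b) () = 2 / real n * ?b" by (simp add: shift_def)
    \<comment> \<open>The left side allows for rounding: the product is at least
      \<open>0.35 - 2 / n\<close>, and \<open>n \<ge> 10 ^ 6\<close>.\<close>
    moreover have "0.34999 \<le> real (rounds1 n) * (2 / real n)"
      using r \<open>real n \<ge> 10 ^ 6\<close> by (simp add: field_simps)
    then have "0.34999 * ?b \<le> real (rounds1 n) * (2 / real n) * ?b"
      by (rule mult_right_mono) simp
    ultimately have x: "1 / 10 ^ 4 \<le> ?x" by (simp add: mult.assoc)
    have "?b = 1 / 10 ^ 4 - (1 / 10 ^ 4)\<^sup>2 / 2" by (simp add: power2_eq_square)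
    also have "\<dots> \<le> 1 - exp (- (1 / 10 ^ 4))" by (rule one_minus_exp_ge) simp
    also have "\<dots> \<le> 1 - exp (- ?x)" using x by simp
    also have "\<dots> = mass n (\<lambda>_. ()) {} (\<lambda>_. ?x) ()"
      using mass_const_type[of n "\<lambda>_. ()" "()" "{}" "\<lambda>_. ?x"] comp_isolated[of _ n "{}"] n
      by (simp flip: lessThan_def)
    finally show ?thesis .
  qed
  have "measure_pmf.prob (edge_process n (rounds1 n))
      {es. \<exists>j. mass n (\<lambda>_. ()) (grow (\<lambda>_. ()) ?A es {}) (\<lambda>_. ?h) j < ?b - 1 / 10 ^ 9}
    \<le> exp (4 * real CARD(unit) / ?h) * drift_const (real CARD(unit)) ?h / (1 / 10 ^ 9)\<^sup>2 / n"
  proof (rule mass_process[where \<theta> = "\<lambda>_. ?h" and b = "\<lambda>_. ?b"])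
    have "real (rounds1 n) \<le> real n" using r by simp
    then show "rounds1 n \<le> n" by simp
    show "?b \<le> mass n (\<lambda>_. ()) {} (\<lambda>u. ?h + real (rounds1 n) * shift n ?A (\<lambda>_. ?b) ()) j" for j
      using start by (cases j) simp
  qed (use n in \<open>auto simp: symp_def\<close>)
  moreover have "grow (\<lambda>_. ()) ?A es {} = set es" for es
    by (simp add: grow_def permitted_def)
  moreover have "(\<exists>j. mass n (\<lambda>_. ()) E \<tau> j < c) \<longleftrightarrow> mass n (\<lambda>_. ()) E \<tau> () < c" for E \<tau> c
    by (metis unit_eq)
  ultimately show ?thesis by simp
qed

lemma phase_two_red:
  assumes n: "n \<ge> 10 ^ 6" and T: "T \<subseteq> {..<n}" "T \<inter> \<Union>E = {}" "card T = spare_size n"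
    and E: "99994 / 10 ^ 9 \<le> mass n (\<lambda>_. ()) E (\<lambda>_. 650029 / 10 ^ 10) ()"
  defines "ty \<equiv> \<lambda>v. v \<notin> T"
  shows "measure_pmf.prob (edge_process n (rounds2 n))
      {es. mass n ty (grow ty (\<and>) es E) (\<lambda>_. eta) True < 4 / 10 ^ 5}
    \<le> exp (8 / eta) * drift_const 2 eta / (1 / 10 ^ 5)\<^sup>2 / n"
proof -
  let ?h = "650029 / 10 ^ 10 :: real"
  \<comment> \<open>For \<open>True\<close>: the mass \<open>99994 / 10 ^ 9\<close> minus at most
    \<open>0.641 * ?h\<close> from the isolated vertices of \<open>T\<close>, rounded down.
    Supercriticality is \<open>1.11499 * b True \<ge> ?h\<close>: the whole weight can be spent
    while the mass persists. \<open>False\<close> gets 0, as no red edge of this phase meets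
    \<open>T\<close>.\<close>
  define b :: "bool \<Rightarrow> real" where "b j = (if j then 58327 / 10 ^ 9 else 0)" for j
  have nn: "real n \<ge> 10 ^ 6" using n by simp
  have r: "real (rounds2 n) \<le> 0.5575 * real n" "0.5575 * real n - 1 \<le> real (rounds2 n)"
    unfolding rounds2_def by (rule nat_floor_bounds, simp)+
  have k: "real (card T) \<le> 0.641 * real n"
    unfolding T(3) spare_size_def by (rule nat_floor_bounds) simp
  have iso: "comp n E v = {v}" if "v \<in> T" for v
    by (rule comp_isolated) (use that T in auto)
  have shift: "shift n (\<and>) b True = 2 / real n * (58327 / 10 ^ 9)" "shift n (\<and>) b False = 0"
    by (simp_all add: shift_def UNIV_bool b_def)
  have start: "b True \<le> mass n ty E (\<lambda>u. eta + real (rounds2 n) * shift n (\<and>) b (ty u)) True"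
  proof -
    have split: "{v. v < n} = {v. v < n \<and> ty v = True} \<union> T" "{v. v < n \<and> ty v = True} \<inter> T = {}"
      using T(1) by (auto simp: ty_def)
    have "finite T" by (rule finite_subset[OF T(1)]) simp
    have "(\<Sum>v | v < n. reach n E (\<lambda>_. ?h) v) =
        (\<Sum>v | v < n \<and> ty v = True. reach n E (\<lambda>_. ?h) v) + (\<Sum>v\<in>T. reach n E (\<lambda>_. ?h) v)"
      unfolding split(1) by (rule sum.union_disjoint) (use \<open>finite T\<close> split(2) in auto)
    also have "(\<Sum>v\<in>T. reach n E (\<lambda>_. ?h) v) = real (card T) * (1 - exp (- ?h))"
      by (simp add: reach_def wt_def iso)
    also have "\<dots> \<le> (0.641 * real n) * ?h"
      using exp_ge_add_one_self[of "- ?h"] k by (intro mult_mono) auto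
    finally have "(\<Sum>v | v < n. reach n E (\<lambda>_. ?h) v)
        \<le> (\<Sum>v | v < n \<and> ty v = True. reach n E (\<lambda>_. ?h) v) + (0.641 * real n) * ?h" by simp
    then have "mass n (\<lambda>_. ()) E (\<lambda>_. ?h) () \<le> mass n ty E (\<lambda>_. ?h) True + 0.641 * ?h"
      using nn by (simp add: mass_def field_simps)
    then have "b True \<le> mass n ty E (\<lambda>_. ?h) True"
      using E by (simp add: b_def)
    \<comment> \<open>Vertices of \<open>T\<close> now have only the weight \<open>eta\<close>, but
      no component of a vertex outside \<open>T\<close> contains one, so weights are compared on
      type \<open>True\<close> alone.\<close>
    also have "\<dots> \<le> mass n ty E (\<lambda>u. eta + real (rounds2 n) * shift n (\<and>) b (ty u)) True"
    proof (rule mass_mono)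
      fix u v assume v: "v < n" "ty v = True" and u: "u \<in> comp n E v"
      have "ty u"
      proof (rule ccontr)
        assume "\<not> ty u"
        then have "comp n E u = {u}" by (simp add: ty_def iso)
        moreover have "v \<in> comp n E u" using comp_sym[OF v(1) u] .
        ultimately show False using \<open>\<not> ty u\<close> v by simp
      qed
      have "1.11499 \<le> real (rounds2 n) * (2 / real n)"
        using r nn by (simp add: field_simps)
      then have "1.11499 * (58327 / 10 ^ 9) \<le> real (rounds2 n) * (2 / real n) * (58327 / 10 ^ 9)"
        by (rule mult_right_mono) simp
      moreover have "?h \<le> 1.11499 * (58327 / 10 ^ 9)" by simp
      moreover have "0 \<le> eta" by (simp add: eta_def)
      ultimately show "?h \<le> eta + real (rounds2 n) * shift n (\<and>) b (ty u)"
        using \<open>ty u\<close> shift(1) by (simp only: mult.assoc simp_thms)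
    qed
    finally show ?thesis .
  qed
  have "measure_pmf.prob (edge_process n (rounds2 n))
      {es. mass n ty (grow ty (\<and>) es E) (\<lambda>_. eta) True < 4 / 10 ^ 5}
    \<le> measure_pmf.prob (edge_process n (rounds2 n))
      {es. \<exists>j. mass n ty (grow ty (\<and>) es E) (\<lambda>_. eta) j < b j - 1 / 10 ^ 5}"
  proof (rule measure_pmf.finite_measure_mono)
    have "(4 / 10 ^ 5 :: real) \<le> b True - 1 / 10 ^ 5" by (simp add: b_def)
    then show "{es. mass n ty (grow ty (\<and>) es E) (\<lambda>_. eta) True < 4 / 10 ^ 5} \<subseteq>
      {es. \<exists>j. mass n ty (grow ty (\<and>) es E) (\<lambda>_. eta) j < b j - 1 / 10 ^ 5}"
      using less_le_trans by blast
  qed simp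
  also have "\<dots> \<le> exp (4 * real CARD(bool) / eta) * drift_const (real CARD(bool)) eta / (1 / 10 ^ 5)\<^sup>2 / n"
  proof (rule mass_process[where \<theta> = "\<lambda>_. eta" and b = b])
    have "real (rounds2 n) \<le> real n" using r by simp
    then show "rounds2 n \<le> n" by simp
    show "b j \<le> mass n ty E (\<lambda>u. eta + real (rounds2 n) * shift n (\<and>) b (ty u)) j" for j
    proof (cases j)
      case True
      then show ?thesis using start by simp
    next
      case False
      have "0 \<le> shift n (\<and>) b i" for i by (rule shift_nonneg) (simp add: b_def)
      then have "0 \<le> mass n ty E (\<lambda>u. eta + real (rounds2 n) * shift n (\<and>) b (ty u)) j"
        by (intro mass_nonneg) (simp add: eta_def)
      then show ?thesis using False by (simp add: b_def)
    qed
  qed (use n in \<open>auto simp: symp_def b_def eta_def\<close>)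
  finally show ?thesis by simp
qed

text \<open>Blue starts without edges, so the initial masses are explicit. Supercriticality means
  that the weights spent during the phase give isolated vertices of both types masses of at least
  \<open>b\<close> again.\<close>

lemma phase_two_blue:
  assumes n: "n \<ge> 10 ^ 6" and T: "T \<subseteq> {..<n}" "card T = spare_size n"
  defines "ty \<equiv> \<lambda>v. v \<notin> T"
  shows "measure_pmf.prob (edge_process n (rounds2 n))
      {es. mass n ty (grow ty (\<lambda>i j. \<not> (i \<and> j)) es {}) (\<lambda>_. eta) False < 4 / 10 ^ 5}
    \<le> exp (8 / eta) * drift_const 2 eta / (1 / 10 ^ 5)\<^sup>2 / n"
proof -
  let ?A = "\<lambda>i j. \<not> (i \<and> j)"
  \<comment> \<open>close to the Perron eigenvector of the matrix of the blue mean offspring numbers\<close>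
  define b :: "bool \<Rightarrow> real" where "b j = (if j then 40025 / 10 ^ 9 else 1 / 10 ^ 4)" for j
  have nn: "real n \<ge> 10 ^ 6" using n by simp
  have r: "real (rounds2 n) \<le> 0.5575 * real n" "0.5575 * real n - 1 \<le> real (rounds2 n)"
    unfolding rounds2_def by (rule nat_floor_bounds, simp)+
  have k: "real (card T) \<le> 0.641 * real n" "0.641 * real n - 1 \<le> real (card T)"
    unfolding T(2) spare_size_def by (rule nat_floor_bounds, simp)+
  have "finite T" by (rule finite_subset[OF T(1)]) simp
  have cards: "{v. v < n \<and> ty v = False} = T" "real (card {v. v < n \<and> ty v = True}) = real n - real (card T)"
  proof -
    show "{v. v < n \<and> ty v = False} = T" using T(1) by (auto simp: ty_def)
    have "{v. v < n \<and> ty v = True} = {..<n} - T" by (auto simp: ty_def)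
    moreover have "card T \<le> n" using card_mono[OF _ T(1)] by simp
    ultimately show "real (card {v. v < n \<and> ty v = True}) = real n - real (card T)"
      using card_Diff_subset[OF \<open>finite T\<close> T(1)] by (simp add: of_nat_diff)
  qed
  have x2: "1.11499 \<le> real (rounds2 n) * (2 / real n)"
    using r nn by (simp add: field_simps)
  have shift: "shift n ?A b True = 2 / real n * (1 / 10 ^ 4)"
    "shift n ?A b False = 2 / real n * (140025 / 10 ^ 9)"
    by (simp_all add: shift_def UNIV_bool b_def)
  have eta0: "0 \<le> eta" by (simp add: eta_def)
  have start: "b j \<le> mass n ty {} (\<lambda>u. eta + real (rounds2 n) * shift n ?A b (ty u)) j" for j
  proof -
    let ?x = "\<lambda>i. eta + real (rounds2 n) * shift n ?A b i"
    have *: "y - y\<^sup>2 / 2 \<le> 1 - exp (- ?x i)"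
      if "0 \<le> y" "y \<le> real (rounds2 n) * shift n ?A b i" for i y
    proof -
      have "y - y\<^sup>2 / 2 \<le> 1 - exp (- y)" by (rule one_minus_exp_ge[OF that(1)])
      also have "\<dots> \<le> 1 - exp (- ?x i)" using that eta0 by simp
      finally show ?thesis .
    qed
    have mass: "mass n ty {} (\<lambda>u. ?x (ty u)) i = real (card {v. v < n \<and> ty v = i}) / real n * (1 - exp (- ?x i))" for i
      by (rule mass_const_type, rule comp_isolated) auto
    show ?thesis
    proof (cases j)
      case True
      \<comment> \<open>\<open>1.11499 * b False\<close>: in blue, vertices of type
        \<open>True\<close> join only type \<open>False\<close>.\<close>
      let ?y = "111499 / 10 ^ 9 :: real"
      have "1.11499 * (1 / 10 ^ 4) \<le> real (rounds2 n) * (2 / real n) * (1 / 10 ^ 4)"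
        using x2 by (rule mult_right_mono) simp
      then have "?y \<le> real (rounds2 n) * shift n ?A b True"
        unfolding shift by simp
      from *[OF _ this] have e: "?y - ?y\<^sup>2 / 2 \<le> 1 - exp (- ?x True)" by simp
      have c: "0.359 \<le> real (card {v. v < n \<and> ty v = True}) / real n"
        unfolding cards using k nn by (simp add: field_simps)
      have "b True \<le> 0.359 * (?y - ?y\<^sup>2 / 2)" by (simp add: b_def power2_eq_square)
      also have "\<dots> \<le> real (card {v. v < n \<and> ty v = True}) / real n * (1 - exp (- ?x True))"
        by (intro mult_mono c e) (simp_all add: power2_eq_square)
      finally show ?thesis using True mass[of True] by simp
    next
      case False
      \<comment> \<open>\<open>1.11499 * (b True + b False)\<close>, rounded down: vertices of
        \<open>T\<close> join both types.\<close>
      let ?y = "156126 / 10 ^ 9 :: real"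
      have "1.11499 * (140025 / 10 ^ 9) \<le> real (rounds2 n) * (2 / real n) * (140025 / 10 ^ 9)"
        using x2 by (rule mult_right_mono) simp
      then have "?y \<le> real (rounds2 n) * shift n ?A b False"
        unfolding shift by simp
      from *[OF _ this] have e: "?y - ?y\<^sup>2 / 2 \<le> 1 - exp (- ?x False)" by simp
      have c: "0.64099 \<le> real (card {v. v < n \<and> ty v = False}) / real n"
        unfolding cards using k nn by (simp add: field_simps)
      have "b False \<le> 0.64099 * (?y - ?y\<^sup>2 / 2)" by (simp add: b_def power2_eq_square)
      also have "\<dots> \<le> real (card {v. v < n \<and> ty v = False}) / real n * (1 - exp (- ?x False))"
        by (intro mult_mono c e) (simp_all add: power2_eq_square)
      finally show ?thesis using False mass[of False] by simp
    qed
  qed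
  have "measure_pmf.prob (edge_process n (rounds2 n))
      {es. mass n ty (grow ty ?A es {}) (\<lambda>_. eta) False < 4 / 10 ^ 5}
    \<le> measure_pmf.prob (edge_process n (rounds2 n))
      {es. \<exists>j. mass n ty (grow ty ?A es {}) (\<lambda>_. eta) j < b j - 1 / 10 ^ 5}"
  proof (rule measure_pmf.finite_measure_mono)
    have "(4 / 10 ^ 5 :: real) \<le> b False - 1 / 10 ^ 5" by (simp add: b_def)
    then show "{es. mass n ty (grow ty ?A es {}) (\<lambda>_. eta) False < 4 / 10 ^ 5} \<subseteq>
      {es. \<exists>j. mass n ty (grow ty ?A es {}) (\<lambda>_. eta) j < b j - 1 / 10 ^ 5}"
      using less_le_trans by blast
  qed simp
  also have "\<dots> \<le> exp (4 * real CARD(bool) / eta) * drift_const (real CARD(bool)) eta / (1 / 10 ^ 5)\<^sup>2 / n"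
  proof (rule mass_process[where \<theta> = "\<lambda>_. eta" and b = b])
    have "real (rounds2 n) \<le> real n" using r by simp
    then show "rounds2 n \<le> n" by simp
    show "b j \<le> mass n ty {} (\<lambda>u. eta + real (rounds2 n) * shift n ?A b (ty u)) j" for j
      by (rule start)
  qed (use n in \<open>auto simp: symp_def b_def eta_def\<close>)
  finally show ?thesis by simp
qed

section \<open>Conditioning on phases and creating a giant component\<close>

lemma prob_edge_process_add_le:
  assumes n: "n \<ge> 2" and d: "d \<ge> 0"
    and le: "\<And>xs. length xs = m \<Longrightarrow> set xs \<subseteq> all_edges n \<Longrightarrow> xs \<notin> B \<Longrightarrow>
      measure_pmf.prob (edge_process n k) {ys. xs @ ys \<in> X} \<le> d"
  shows "measure_pmf.prob (edge_process n (m + k)) X \<le> measure_pmf.prob (edge_process n m) B + d"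
  unfolding edge_process_def
proof (rule prob_replicate_pmf_add_le[OF _ d])
  fix xs assume xs: "xs \<in> set_pmf (replicate_pmf m (pmf_of_set (all_edges n)))" "xs \<notin> B"
  then have "length xs = m" "set xs \<subseteq> all_edges n"
    using edge_processD[of xs n m] n by (simp_all add: edge_process_def)
  then show "measure_pmf.prob (replicate_pmf k (pmf_of_set (all_edges n))) {ys. xs @ ys \<in> X} \<le> d"
    using le xs(2) unfolding edge_process_def by blast
qed (use n in simp)

text \<open>\<open>1 / 150000\<close> is a third of \<open>1 / 50000\<close>, the proportion of
  vertices known to lie in large components before sprinkling.\<close>

definition giant :: "nat \<Rightarrow> edge set \<Rightarrow> bool" where
  "giant n E \<longleftrightarrow> (\<exists>v<n. real n / 150000 \<le> real (card (comp n E v)))"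

lemma giant_mono:
  assumes "giant n E" "E \<subseteq> E'"
  shows "giant n E'"
proof -
  obtain v where v: "v < n" "real n / 150000 \<le> real (card (comp n E v))"
    using assms(1) by (auto simp: giant_def)
  have "card (comp n E v) \<le> card (comp n E' v)"
    by (intro card_mono comp_mono assms(2)) simp
  with v show ?thesis unfolding giant_def by (intro exI[of _ v]) simp
qed

lemma giant_iff:
  "giant n E \<longleftrightarrow> (\<exists>C \<in> graph_components {..<n} E. 1 / 150000 * real n \<le> real (card C))"
  unfolding giant_def graph_components_def by auto

text \<open>The sprinkling estimate for \<open>M = 10 ^ 15\<close>, \<open>c = 1 / 50000\<close> and
  \<open>n / 4000 - 1\<close> new edges, with \<open>ln 2\<close> replaced by 1.\<close>

definition sprinkle_bound :: "nat \<Rightarrow> real" where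
  "sprinkle_bound n = exp (real n / 10 ^ 15 - (real n / 4000 - 1) * ((1 / 50000)\<^sup>2 / 9))"

lemma sprinkle_giant:
  assumes n: "n \<ge> 10 ^ 6" and m: "real n / 4000 - 1 \<le> real m"
    and mass: "4 / 10 ^ 5 \<le> mass n ty E (\<lambda>_. eta) j"
  shows "measure_pmf.prob (edge_process n m) {es. \<not> giant n (E \<union> set es)} \<le> sprinkle_bound n"
proof -
  \<comment> \<open>\<open>1 / 50000 + eta * 10 ^ 15\<close> is \<open>3 / 10 ^ 5\<close>, below the
    available mass \<open>4 / 10 ^ 5\<close>.\<close>
  have "1 / 50000 * real n \<le> real (card {v. v < n \<and> 10 ^ 15 \<le> card (comp n E v)})"
    by (rule card_large_components_ge[where \<eta> = eta and ty = ty and j = j])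
      (use n mass in \<open>simp_all add: eta_def\<close>)
  then have "measure_pmf.prob (edge_process n m)
      {es. \<forall>v<n. real (card (comp n (E \<union> set es) v)) < 1 / 50000 / 3 * real n}
    \<le> exp (ln 2 * (real n / real (10 ^ 15)) - real m * ((1 / 50000)\<^sup>2 / 9))"
    by (intro sprinkling) (use n in simp_all)
  also have "\<dots> \<le> sprinkle_bound n"
    unfolding sprinkle_bound_def
  proof (intro exp_mono diff_mono mult_right_mono m)
    have "ln 2 * (real n / 10 ^ 15) \<le> 1 * (real n / 10 ^ 15)"
      using ln_2_less_1 by (intro mult_right_mono) auto
    then show "ln 2 * (real n / real (10 ^ 15)) \<le> real n / 10 ^ 15" by simp
  qed simp
  also have "{es. \<forall>v<n. real (card (comp n (E \<union> set es) v)) < 1 / 50000 / 3 * real n} =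
      {es. \<not> giant n (E \<union> set es)}"
    by (auto simp: giant_def not_le)
  finally show ?thesis .
qed

text \<open>From \<open>mass_process\<close>: one type with \<open>\<sigma> = 1 / 10 ^ 9\<close> in
  the first phase, then two types with \<open>\<sigma> = 1 / 10 ^ 5\<close>, once per colour.
  Astronomically large, but independent of \<open>n\<close>.\<close>

definition concentration_const :: real where
  "concentration_const = exp (4 / (650029 / 10 ^ 10)) * drift_const 1 (650029 / 10 ^ 10) / (1 / 10 ^ 9)\<^sup>2
    + 2 * (exp (8 / eta) * drift_const 2 eta / (1 / 10 ^ 5)\<^sup>2)"

subsection \<open>Combining the phases\<close>

text \<open>Given the earlier phases, \<open>T\<close> and the graphs built so far are fixed, so
  each bound applies to fresh edges. The third phase creates the red giant and the fourth the blue
  one.\<close>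

lemma strategy_failure_prob:
  assumes n: "n \<ge> 10 ^ 6"
  shows "measure_pmf.prob (edge_process n (nat \<lfloor>0.733 * real n\<rfloor>))
      {es. \<exists>k. \<not> giant n (colour_class (strategy n) es k)}
    \<le> concentration_const / n + 2 * sprinkle_bound n"
proof -
  let ?Q = "exp (8 / eta) * drift_const 2 eta / (1 / 10 ^ 5)\<^sup>2 / n"
  let ?fail = "{es. \<exists>k. \<not> giant n (colour_class (strategy n) es k)}"
  have n2: "n \<ge> 2" using n by simp
  have r: "real (rounds1 n) \<le> 0.175 * real n" "real (rounds2 n) \<le> 0.5575 * real n"
    "real (rounds3 n) \<le> 0.00025 * real n" "0.00025 * real n - 1 \<le> real (rounds3 n)"
    "0.733 * real n - 1 \<le> real (nat \<lfloor>0.733 * real n\<rfloor>)"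
    unfolding rounds1_def rounds2_def rounds3_def by (rule nat_floor_bounds, simp)+
  \<comment> \<open>Rounding down the earlier phases only lengthens the last one, which therefore
    keeps at least \<open>n / 4000 - 1\<close> rounds.\<close>
  define rest where "rest = nat \<lfloor>0.733 * real n\<rfloor> - (rounds1 n + rounds2 n + rounds3 n)"
  have "real (rounds1 n + rounds2 n + rounds3 n) \<le> 0.733 * real n"
    using r by simp
  then have le: "rounds1 n + rounds2 n + rounds3 n \<le> nat \<lfloor>0.733 * real n\<rfloor>"
    by (rule le_nat_floor)
  then have total: "nat \<lfloor>0.733 * real n\<rfloor> = rounds1 n + (rounds2 n + (rounds3 n + rest))"
    by (simp add: rest_def)
  have slack: "x / 4000 - 1 \<le> f - (a + b + c)"
    if "a \<le> 0.175 * x" "b \<le> 0.5575 * x" "c \<le> 0.00025 * x" "0.733 * x - 1 \<le> f" for a b c f x :: real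
    using that by simp
  have "real rest = real (nat \<lfloor>0.733 * real n\<rfloor>) - real (rounds1 n + rounds2 n + rounds3 n)"
    unfolding rest_def using le by (rule of_nat_diff)
  then have rest: "real n / 4000 - 1 \<le> real rest"
    using slack[OF r(1-3,5)] by (simp only: of_nat_add)
  have r3: "real n / 4000 - 1 \<le> real (rounds3 n)" using r by simp
  have sp: "0 \<le> sprinkle_bound n" by (simp add: sprinkle_bound_def)
  have Q: "0 \<le> ?Q" using drift_const_nonneg[of 2 eta] by simp
  let ?B1 = "{es. mass n (\<lambda>_. ()) (set es) (\<lambda>_. 650029 / 10 ^ 10) () < 99994 / 10 ^ 9}"
  have "measure_pmf.prob (edge_process n (rounds1 n + (rounds2 n + (rounds3 n + rest)))) ?fail
    \<le> measure_pmf.prob (edge_process n (rounds1 n)) ?B1 + (2 * ?Q + 2 * sprinkle_bound n)"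
  proof (rule prob_edge_process_add_le[OF n2])
    fix es1
    assume es1: "length es1 = rounds1 n" "set es1 \<subseteq> all_edges n" "es1 \<notin> ?B1"
    define T where "T = spare n es1"
    define ty where "ty v \<longleftrightarrow> v \<notin> T" for v
    note T = spare_props[OF es1(2,1), folded T_def]
    let ?R = "\<lambda>es. grow ty (\<and>) es (set es1)" and ?Bl = "\<lambda>es. grow ty (\<lambda>i j. \<not> (i \<and> j)) es {}"
    let ?BR = "{es. mass n ty (?R es) (\<lambda>_. eta) True < 4 / 10 ^ 5}"
    let ?BB = "{es. mass n ty (?Bl es) (\<lambda>_. eta) False < 4 / 10 ^ 5}"
    have ty: "ty = (\<lambda>v. v \<notin> T)" by (simp add: ty_def fun_eq_iff)
    have "measure_pmf.prob (edge_process n (rounds2 n + (rounds3 n + rest))) {ys. es1 @ ys \<in> ?fail}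
      \<le> measure_pmf.prob (edge_process n (rounds2 n)) (?BR \<union> ?BB) + 2 * sprinkle_bound n"
    proof (rule prob_edge_process_add_le[OF n2])
      fix es2
      assume es2: "length es2 = rounds2 n" "set es2 \<subseteq> all_edges n" "es2 \<notin> ?BR \<union> ?BB"
      let ?B3 = "{es. \<not> giant n (?R es2 \<union> set es)}"
      have "measure_pmf.prob (edge_process n (rounds3 n + rest)) {ys. es2 @ ys \<in> {ys. es1 @ ys \<in> ?fail}}
        \<le> measure_pmf.prob (edge_process n (rounds3 n)) ?B3 + sprinkle_bound n"
      proof (rule prob_edge_process_add_le[OF n2 sp])
        fix es3
        assume es3: "length es3 = rounds3 n" "set es3 \<subseteq> all_edges n" "es3 \<notin> ?B3"
        have "{ys. es3 @ ys \<in> {ys. es2 @ ys \<in> {ys. es1 @ ys \<in> ?fail}}} \<subseteq> {es. \<not> giant n (?Bl es2 \<union> set es)}"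
        proof
          fix es4
          assume "es4 \<in> {ys. es3 @ ys \<in> {ys. es2 @ ys \<in> {ys. es1 @ ys \<in> ?fail}}}"
          then obtain k where k: "\<not> giant n (colour_class (strategy n) (es1 @ es2 @ es3 @ es4) k)" by auto
          note classes = strategy_classes[OF es1(1) es2(1) es3(1), of es4, folded T_def]
          have two: "card e = 2" if "e \<in> set es2" for e
            using that es2(2) all_edgesD by blast
          have "?R es2 \<union> set es3 \<subseteq> colour_class (strategy n) (es1 @ es2 @ es3 @ es4) Red"
            using classes(1) two permitted_iff_disjoint(1)[of _ T] unfolding grow_def ty by blast
          moreover have "giant n (?R es2 \<union> set es3)" using es3(3) by simp
          ultimately have "k \<noteq> Red" using k giant_mono by blast
          then have "k = Blue" by (cases k) auto
          moreover have "?Bl es2 \<union> set es4 \<subseteq> colour_class (strategy n) (es1 @ es2 @ es3 @ es4) Blue"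
            using classes(2) two permitted_iff_disjoint(2)[of _ T] unfolding grow_def ty by blast
          ultimately have "\<not> giant n (?Bl es2 \<union> set es4)" using k giant_mono by blast
          then show "es4 \<in> {es. \<not> giant n (?Bl es2 \<union> set es)}" by simp
        qed
        then have "measure_pmf.prob (edge_process n rest) {ys. es3 @ ys \<in> {ys. es2 @ ys \<in> {ys. es1 @ ys \<in> ?fail}}}
            \<le> measure_pmf.prob (edge_process n rest) {es. \<not> giant n (?Bl es2 \<union> set es)}"
          by (rule measure_pmf.finite_measure_mono) simp
        also have "\<dots> \<le> sprinkle_bound n"
          by (rule sprinkle_giant[OF n rest, where ty = ty and j = False]) (use es2(3) in simp)
        finally show "measure_pmf.prob (edge_process n rest)
            {ys. es3 @ ys \<in> {ys. es2 @ ys \<in> {ys. es1 @ ys \<in> ?fail}}} \<le> sprinkle_bound n" .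
      qed
      moreover have "measure_pmf.prob (edge_process n (rounds3 n)) ?B3 \<le> sprinkle_bound n"
        by (rule sprinkle_giant[OF n r3, where ty = ty and j = True]) (use es2(3) in simp)
      ultimately show "measure_pmf.prob (edge_process n (rounds3 n + rest))
          {ys. es2 @ ys \<in> {ys. es1 @ ys \<in> ?fail}} \<le> 2 * sprinkle_bound n" by linarith
    qed (use sp in simp)
    \<comment> \<open>The same rounds drive both colours; a union bound needs no independence
      between them.\<close>
    moreover have "measure_pmf.prob (edge_process n (rounds2 n)) (?BR \<union> ?BB)
        \<le> measure_pmf.prob (edge_process n (rounds2 n)) ?BR + measure_pmf.prob (edge_process n (rounds2 n)) ?BB"
      by (rule measure_subadditive) auto
    moreover have "measure_pmf.prob (edge_process n (rounds2 n)) ?BR \<le> ?Q"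
      unfolding ty by (rule phase_two_red[OF n T]) (use es1(3) in simp)
    moreover have "measure_pmf.prob (edge_process n (rounds2 n)) ?BB \<le> ?Q"
      unfolding ty by (rule phase_two_blue[OF n T(1,3)])
    ultimately show "measure_pmf.prob (edge_process n (rounds2 n + (rounds3 n + rest))) {ys. es1 @ ys \<in> ?fail}
        \<le> 2 * ?Q + 2 * sprinkle_bound n" by linarith
  qed (use sp Q in simp)
  also have "\<dots> \<le> concentration_const / n + 2 * sprinkle_bound n"
    using phase_one_red[OF n] unfolding concentration_const_def by (simp add: add_divide_distrib)
  finally show ?thesis unfolding total .
qed

theorem theorem1p6:
  "\<exists>(A :: nat \<Rightarrow> online_algorithm) (c :: real). c > 0 \<and>
     (\<lambda>n. measure_pmf.prob (edge_process n (nat \<lfloor>0.733 * real n\<rfloor>))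
        {es. \<forall>k. \<exists>C \<in> graph_components {..<n} (colour_class (A n) es k). real (card C) \<ge> c * real n})
     \<longlonglongrightarrow> 1"
proof (intro exI conjI)
  show "(1 / 150000 :: real) > 0" by simp
  let ?P = "\<lambda>n. measure_pmf.prob (edge_process n (nat \<lfloor>0.733 * real n\<rfloor>))
        {es. \<forall>k. \<exists>C \<in> graph_components {..<n} (colour_class (strategy n) es k). real (card C) \<ge> 1 / 150000 * real n}"
  have "(\<lambda>n. concentration_const / real n) \<longlonglongrightarrow> 0"
    by (rule lim_const_over_n)
  moreover have "sprinkle_bound \<longlonglongrightarrow> 0"
  proof -
    \<comment> \<open>\<open>?l\<close> is
      \<open>1 / (4000 * 9 * 50000\<^sup>2) - 1 / 10 ^ 15\<close>, and \<open>?k\<close> comes from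
      the \<open>- 1\<close> in \<open>n / 4000 - 1\<close>. That \<open>?l\<close> is positive is
      what makes sprinkling win against the number of splits.\<close>
    let ?l = "91 / (9 * 10 ^ 15) :: real" and ?k = "4 / (9 * 10 ^ 10) :: real"
    have "sprinkle_bound = (\<lambda>n. exp ?k * exp (- ?l) ^ n)"
      unfolding sprinkle_bound_def exp_of_nat_mult[symmetric] exp_add[symmetric]
      by (intro ext arg_cong[where f = exp]) (simp add: power2_eq_square field_simps)
    moreover have "(\<lambda>n. exp ?k * exp (- ?l) ^ n) \<longlonglongrightarrow> exp ?k * 0"
      by (intro tendsto_mult tendsto_const LIMSEQ_realpow_zero) simp_all
    ultimately show ?thesis by simp
  qed
  ultimately have "(\<lambda>n. 1 - (concentration_const / real n + 2 * sprinkle_bound n)) \<longlonglongrightarrow> 1 - (0 + 2 * 0)"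
    by (intro tendsto_intros)
  then have lower: "(\<lambda>n. 1 - (concentration_const / real n + 2 * sprinkle_bound n)) \<longlonglongrightarrow> 1" by simp
  show "?P \<longlonglongrightarrow> 1"
  proof (rule tendsto_sandwich[OF _ _ lower tendsto_const])
    show "\<forall>\<^sub>F n in sequentially. 1 - (concentration_const / real n + 2 * sprinkle_bound n) \<le> ?P n"
      using eventually_ge_at_top[of "10 ^ 6"]
    proof eventually_elim
      case (elim n)
      have "{es. \<exists>k. \<not> giant n (colour_class (strategy n) es k)} = UNIV - {es. \<forall>k. \<exists>C \<in> graph_components {..<n}
          (colour_class (strategy n) es k). real (card C) \<ge> 1 / 150000 * real n}"
        by (auto simp: giant_iff)
      then show ?case
        using strategy_failure_prob[OF elim] measure_pmf.prob_compl[of _ "edge_process n (nat \<lfloor>0.733 * real n\<rfloor>)"]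
        by simp
    qed
  qed simp
qed

end
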